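(* Let $n,d\ge 1$, let $G^\star\in\mathcal{O}(d)^n$, let $\Delta\in\mathbb{R}^{nd\times nd}$ be symmetric, and let $C=G^\star G^{\star\top}+\Delta$. Let $\widehat{G}\in\mathcal{O}(d)^n$ be a global maximizer of $G\mapsto \operatorname{tr}(G^\top C G)$ over $\mathcal{O}(d)^n$. Suppose that $\|\Delta\|\le \frac{n^{3/4}}{20 d^{1/2}}$ and $\|\Delta G^\star\|_\infty\le \frac{n}{20}$. Put $$\rho_F=\frac{1}{10}\min\Big\{\sqrt{n},\frac{n}{\|\Delta\|}\Big\},\qquad \rho_\infty=\frac14 .$$ Then for any $G\in\mathcal{O}(d)^n$ satisfying $\operatorname{d}_F([G],[\widehat{G}])\le\rho_F$ and $\|G\widehat{Q}-\widehat{G}\|_\infty\le\rho_\infty$, where $\widehat{Q}\in\mathcal{O}(d)$ satisfies $\operatorname{d}_F([G],[\widehat{G}])=\|G\widehat{Q}-\widehat{G}\|_F$, it holds that $$-\big\langle \operatorname{Hess} f([G])[H],H\big\rangle_{[G]}\ \ge\ \frac{n}{5}\,\langle H,H\rangle_{[G]}\ >\ 0\qquad\text{for all } H\in \operatorname{T}_{[G]}\mathcal{Q}\setminus\{0\},$$ where $f:\mathcal{Q}\to\mathbb{R}$, $f([G])=\operatorname{tr}(G^\top C G)$, and $\operatorname{Hess} f$ is its Riemannian Hessian on the quotient manifold $\mathcal{Q}=\mathcal{O}(d)^n/\mathcal{O}(d)$.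
   Context: Block notation: $X\in\mathbb{R}^{nd\times d}$ is written $X=[X_1;\dots;X_n]$ with $d\times d$ blocks $X_i$ stacked in a column; $\mathcal{O}(d)^n$ is the set of such $X$ with every $X_i$ orthogonal. $\|\cdot\|$ is the operator norm, $\|\cdot\|_F$ the Frobenius norm, and $\|X\|_\infty:=\max_i\|X_i\|_F$ for $X\in\mathbb{R}^{nd\times d}$. For $X,Y\in\mathbb{R}^{nd\times d}$, $[X]=\{XQ: Q\in\mathcal{O}(d)\}$ and $\operatorname{d}_F([X],[Y]):=\min_{Q\in\mathcal{O}(d)}\|X-YQ\|_F$. $\mathcal{O}(d)^n$ is a Riemannian submanifold of $\mathbb{R}^{nd\times d}$ with the metric induced by $\langle X,Y\rangle=\operatorname{tr}(X^\top Y)$. $\mathcal{O}(d)$ acts on it by $(G,Q)\mapsto GQ$, and $\mathcal{Q}=\mathcal{O}(d)^n/\mathcal{O}(d)$ is the quotient manifold with projection $\pi(G)=[G]$ and with the Riemannian metric $\langle\cdot,\cdot\rangle_{[G]}$ making $\pi$ a Riemannian submersion: the inner product of two tangent vectors at $[G]$ is the Frobenius inner product of their horizontal lifts at $G$, where the horizontal space at $G$ is the orthogonal complement in $\operatorname{T}_G\mathcal{O}(d)^n$ of $\operatorname{T}_G(\pi^{-1}([G]))$. The Riemannian Hessian is $\operatorname{Hess} f([G])[H]=\nabla_H\operatorname{grad} f$ with $\nabla$ the Levi-Civita connection of $\mathcal{Q}$. If $\Delta=0$, $n/\|\Delta\|$ is read as $+\infty$. *)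

theory Defs
  imports "HOL-Analysis.Analysis"
begin

section \<open>Smooth maps between Euclidean spaces\<close>

text \<open>In finite dimension, f is of class C(k+1) on an open set iff it is differentiable there and
  all its directional derivatives are of class C(k). Only used for open \<^term>\<open>U\<close>.\<close>

primrec Ck_on :: "nat \<Rightarrow> 'a::real_normed_vector set \<Rightarrow> ('a \<Rightarrow> 'b::real_normed_vector) \<Rightarrow> bool" where
  "Ck_on 0 U f \<longleftrightarrow> continuous_on U f"
| "Ck_on (Suc k) U f \<longleftrightarrow> (\<forall>x\<in>U. f differentiable (at x)) \<and>
     (\<forall>v. Ck_on k U (\<lambda>x. frechet_derivative f (at x) v))"

definition smooth_on :: "'a::real_normed_vector set \<Rightarrow> ('a \<Rightarrow> 'b::real_normed_vector) \<Rightarrow> bool" where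
  "smooth_on U f \<longleftrightarrow> (\<forall>k. Ck_on k U f)"


section \<open>Embedded submanifolds of a Euclidean space\<close>

definition smooth_functions :: "'a::euclidean_space set \<Rightarrow> ('a \<Rightarrow> real) set" where
  "smooth_functions E = {F. \<forall>x\<in>E. \<exists>U F'. open U \<and> x \<in> U \<and> smooth_on U F' \<and> (\<forall>y\<in>U \<inter> E. F y = F' y)}"

definition smooth_path_in :: "'a::euclidean_space set \<Rightarrow> (real \<Rightarrow> 'a) \<Rightarrow> bool" where
  "smooth_path_in E \<gamma> \<longleftrightarrow> (\<forall>t. \<gamma> t \<in> E) \<and> smooth_on UNIV \<gamma>"

definition embedded_tangent :: "'a::euclidean_space set \<Rightarrow> 'a \<Rightarrow> 'a set" where
  "embedded_tangent E x =
     {V. \<exists>\<gamma>. smooth_path_in E \<gamma> \<and> \<gamma> 0 = x \<and> (\<gamma> has_vector_derivative V) (at 0)}"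


section \<open>Abstract Riemannian manifolds\<close>

text \<open>A manifold is given by its set of points \<^term>\<open>M\<close> and its set \<^term>\<open>S\<close> of smooth real
  functions; membership in \<^term>\<open>S\<close> is only meant to depend on the values on \<^term>\<open>M\<close>. A tangent
  vector is the operator that differentiates smooth functions along a smooth curve. Tangent
  vectors vanish on functions outside \<^term>\<open>S\<close> and vector fields vanish off \<^term>\<open>M\<close>, so that
  equality of either is equality in HOL.\<close>

type_synonym 'q tvec = "('q \<Rightarrow> real) \<Rightarrow> real"
type_synonym 'q vfield = "'q \<Rightarrow> 'q tvec"

definition smooth_curve :: "'q set \<Rightarrow> ('q \<Rightarrow> real) set \<Rightarrow> (real \<Rightarrow> 'q) \<Rightarrow> bool" where
  "smooth_curve M S c \<longleftrightarrow> (\<forall>t. c t \<in> M) \<and> (\<forall>F\<in>S. smooth_on UNIV (\<lambda>t. F (c t)))"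

definition velocity :: "('q \<Rightarrow> real) set \<Rightarrow> (real \<Rightarrow> 'q) \<Rightarrow> 'q tvec" where
  "velocity S c = (\<lambda>F. if F \<in> S then deriv (\<lambda>t. F (c t)) 0 else 0)"

definition zero_tvec :: "'q tvec" where
  "zero_tvec = (\<lambda>F. 0)"

definition tangent_space :: "'q set \<Rightarrow> ('q \<Rightarrow> real) set \<Rightarrow> 'q \<Rightarrow> 'q tvec set" where
  "tangent_space M S q = {v. \<exists>c. smooth_curve M S c \<and> c 0 = q \<and> v = velocity S c}"

definition vector_fields :: "'q set \<Rightarrow> ('q \<Rightarrow> real) set \<Rightarrow> 'q vfield set" where
  "vector_fields M S = {X. (\<forall>q\<in>M. X q \<in> tangent_space M S q) \<and> (\<forall>q. q \<notin> M \<longrightarrow> X q = zero_tvec) \<and>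
     (\<forall>F\<in>S. (\<lambda>q. X q F) \<in> S)}"

definition vf_add :: "'q vfield \<Rightarrow> 'q vfield \<Rightarrow> 'q vfield" where
  "vf_add X Y = (\<lambda>q F. X q F + Y q F)"

definition vf_mult :: "('q \<Rightarrow> real) \<Rightarrow> 'q vfield \<Rightarrow> 'q vfield" where
  "vf_mult h X = (\<lambda>q F. h q * X q F)"

definition lie_bracket :: "'q vfield \<Rightarrow> 'q vfield \<Rightarrow> 'q vfield" where
  "lie_bracket X Y = (\<lambda>q F. X q (\<lambda>p. Y p F) - Y q (\<lambda>p. X p F))"

type_synonym 'q metric_tensor = "'q \<Rightarrow> 'q tvec \<Rightarrow> 'q tvec \<Rightarrow> real"
type_synonym 'q connection = "'q vfield \<Rightarrow> 'q vfield \<Rightarrow> 'q vfield"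

definition affine_connection :: "'q set \<Rightarrow> ('q \<Rightarrow> real) set \<Rightarrow> 'q connection \<Rightarrow> bool" where
  "affine_connection M S nabla \<longleftrightarrow>
     (\<forall>X\<in>vector_fields M S. \<forall>Y\<in>vector_fields M S. \<forall>Z\<in>vector_fields M S. \<forall>h\<in>S.
        nabla X Y \<in> vector_fields M S \<and>
        nabla (vf_add X Y) Z = vf_add (nabla X Z) (nabla Y Z) \<and>
        nabla (vf_mult h X) Y = vf_mult h (nabla X Y) \<and>
        nabla X (vf_add Y Z) = vf_add (nabla X Y) (nabla X Z) \<and>
        nabla X (vf_mult h Y) = vf_add (vf_mult (\<lambda>q. X q h) Y) (vf_mult h (nabla X Y)))"

definition torsion_free :: "'q set \<Rightarrow> ('q \<Rightarrow> real) set \<Rightarrow> 'q connection \<Rightarrow> bool" where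
  "torsion_free M S nabla \<longleftrightarrow>
     (\<forall>X\<in>vector_fields M S. \<forall>Y\<in>vector_fields M S. \<forall>q\<in>M. \<forall>F\<in>S.
        nabla X Y q F - nabla Y X q F = lie_bracket X Y q F)"

definition metric_compatible ::
    "'q set \<Rightarrow> ('q \<Rightarrow> real) set \<Rightarrow> 'q metric_tensor \<Rightarrow> 'q connection \<Rightarrow> bool" where
  "metric_compatible M S g nabla \<longleftrightarrow>
     (\<forall>X\<in>vector_fields M S. \<forall>Y\<in>vector_fields M S. \<forall>Z\<in>vector_fields M S. \<forall>q\<in>M.
        X q (\<lambda>p. g p (Y p) (Z p)) = g q (nabla X Y q) (Z q) + g q (Y q) (nabla X Z q))"

text \<open>By the fundamental theorem of Riemannian geometry, exactly one connection satisfies this, up to its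
  values on arguments that are not vector fields.\<close>

definition levi_civita ::
    "'q set \<Rightarrow> ('q \<Rightarrow> real) set \<Rightarrow> 'q metric_tensor \<Rightarrow> 'q connection \<Rightarrow> bool" where
  "levi_civita M S g nabla \<longleftrightarrow>
     affine_connection M S nabla \<and> torsion_free M S nabla \<and> metric_compatible M S g nabla"

definition riem_grad ::
    "'q set \<Rightarrow> ('q \<Rightarrow> real) set \<Rightarrow> 'q metric_tensor \<Rightarrow> ('q \<Rightarrow> real) \<Rightarrow> 'q vfield" where
  "riem_grad M S g f =
     (THE Z. Z \<in> vector_fields M S \<and> (\<forall>q\<in>M. \<forall>v\<in>tangent_space M S q. g q (Z q) v = v f))"

text \<open>The covariant derivative in direction of a single tangent vector \<^term>\<open>H\<close> at \<^term>\<open>q\<close> is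
  evaluated on an arbitrary vector field extending \<^term>\<open>H\<close>, since a connection is tensorial in its
  first argument.\<close>

definition riem_hess ::
    "'q set \<Rightarrow> ('q \<Rightarrow> real) set \<Rightarrow> 'q metric_tensor \<Rightarrow> 'q connection \<Rightarrow> ('q \<Rightarrow> real) \<Rightarrow>
     'q \<Rightarrow> 'q tvec \<Rightarrow> 'q tvec" where
  "riem_hess M S g nabla f q H =
     nabla (SOME X. X \<in> vector_fields M S \<and> X q = H) (riem_grad M S g f) q"


section \<open>Block matrices and the quotient manifold\<close>

text \<open>An \<open>nd \<times> d\<close> matrix has type \<^typ>\<open>real^'d^('n \<times> 'd)\<close> with \<open>n = CARD('n)\<close> and \<open>d = CARD('d)\<close>;
  its rows are indexed by pairs (block, row within the block). On this type \<^const>\<open>norm\<close> is the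
  Frobenius norm and \<^const>\<open>inner\<close> is \<open>tr(X\<^sup>TY)\<close>.\<close>

definition block :: "real^'d^('n::finite \<times> 'd::finite) \<Rightarrow> 'n \<Rightarrow> real^'d^'d" where
  "block X i = (\<chi> a b. X $ (i, a) $ b)"

definition block_norm_inf :: "real^'d^('n::finite \<times> 'd::finite) \<Rightarrow> real" where
  "block_norm_inf X = Max (range (\<lambda>i. norm (block X i)))"

definition op_norm :: "real^'k^('m::finite) \<Rightarrow> real" where
  "op_norm A = onorm (\<lambda>x. A *v x)"

definition ortho_prod :: "(real^'d^('n::finite \<times> 'd::finite)) set" where
  "ortho_prod = {X. \<forall>i. orthogonal_matrix (block X i)}"

definition ortho_class :: "real^'d^('n::finite \<times> 'd::finite) \<Rightarrow> (real^'d^('n \<times> 'd)) set" where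
  "ortho_class X = {X ** Q |Q. orthogonal_matrix Q}"

text \<open>\<open>dist_F X Y\<close> is the distance of the classes of \<open>X\<close> and \<open>Y\<close>. The infimum is a minimum because
  the orthogonal group is compact.\<close>

definition dist_F :: "real^'d^('n::finite \<times> 'd::finite) \<Rightarrow> real^'d^('n \<times> 'd) \<Rightarrow> real" where
  "dist_F X Y = (INF Q\<in>{Q. orthogonal_matrix Q}. norm (X - Y ** Q))"

definition quot :: "(real^'d^('n::finite \<times> 'd::finite)) set set" where
  "quot = ortho_class ` ortho_prod"

text \<open>The projection is a surjective submersion, so a function on the quotient is smooth iff its
  pullback is.\<close>

definition quot_smooth :: "((real^'d^('n::finite \<times> 'd::finite)) set \<Rightarrow> real) set" where
  "quot_smooth = {F. (\<lambda>G. F (ortho_class G)) \<in> smooth_functions ortho_prod}"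

definition vertical_space :: "real^'d^('n::finite \<times> 'd::finite) \<Rightarrow> (real^'d^('n \<times> 'd)) set" where
  "vertical_space G = embedded_tangent (ortho_class G) G"

definition horizontal_space :: "real^'d^('n::finite \<times> 'd::finite) \<Rightarrow> (real^'d^('n \<times> 'd)) set" where
  "horizontal_space G = {V \<in> embedded_tangent ortho_prod G. \<forall>W\<in>vertical_space G. V \<bullet> W = 0}"

text \<open>\<open>dproj G V v\<close>: the differential of the projection at \<open>G\<close> maps \<open>V\<close> to \<open>v\<close>.\<close>

definition dproj ::
    "real^'d^('n::finite \<times> 'd::finite) \<Rightarrow> real^'d^('n \<times> 'd) \<Rightarrow> (real^'d^('n \<times> 'd)) set tvec \<Rightarrow> bool" where
  "dproj G V v \<longleftrightarrow>
     (\<exists>\<gamma>. smooth_path_in ortho_prod \<gamma> \<and> \<gamma> 0 = G \<and> (\<gamma> has_vector_derivative V) (at 0) \<and>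
          v = velocity quot_smooth (\<lambda>t. ortho_class (\<gamma> t)))"

definition horizontal_lift ::
    "real^'d^('n::finite \<times> 'd::finite) \<Rightarrow> (real^'d^('n \<times> 'd)) set tvec \<Rightarrow> real^'d^('n \<times> 'd)" where
  "horizontal_lift G v = (THE V. V \<in> horizontal_space G \<and> dproj G V v)"

text \<open>The choice of the representative is immaterial: \<open>horizontal_lift (G ** Q) v\<close> equals
  \<open>horizontal_lift G v ** Q\<close>.\<close>

definition quot_metric :: "(real^'d^('n::finite \<times> 'd::finite)) set metric_tensor" where
  "quot_metric q v w = (let G = (SOME G. G \<in> q) in horizontal_lift G v \<bullet> horizontal_lift G w)"

definition objective :: "real^('n \<times> 'd)^('n \<times> 'd) \<Rightarrow> real^'d^('n::finite \<times> 'd::finite) \<Rightarrow> real" where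
  "objective C G = trace (transpose G ** C ** G)"

text \<open>The objective is constant on each class, so its image is a singleton.\<close>

definition quot_objective ::
    "real^('n \<times> 'd)^('n \<times> 'd) \<Rightarrow> (real^'d^('n::finite \<times> 'd::finite)) set \<Rightarrow> real" where
  "quot_objective C q = the_elem (objective C ` q)"

text \<open>For \<open>\<Delta> = 0\<close> the quotient \<open>n / \<parallel>\<Delta>\<parallel>\<close> is read as infinity.\<close>

definition rho_F :: "real^('n \<times> 'd)^('n::finite \<times> 'd::finite) \<Rightarrow> real" where
  "rho_F \<Delta> = (1/10) * (if \<Delta> = 0 then sqrt (real CARD('n))
      else min (sqrt (real CARD('n))) (real CARD('n) / op_norm \<Delta>))"

definition rho_inf :: real where
  "rho_inf = 1/4"

end

theory Submission
  imports Defs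
begin

text \<open>
  Left multiplication by \<open>\<O>(d)\<^sup>n\<close> acts on the quotient by isometries, so a horizontal vector
  \<open>V = (G\<^sub>i A\<^sub>i)\<close> at \<open>G\<close> (\<open>A\<^sub>i\<close> skew, \<open>\<Sum> A\<^sub>i = 0\<close>) extends to a Killing field whose integral curve through
  \<open>[G]\<close> is a geodesic. Differentiating \<open>f\<close> twice along it gives
  \<open>\<langle>Hess f[H], H\<rangle> = 2 \<langle>V, C V\<rangle> + 2 \<Sum> \<langle>G\<^sub>i A\<^sub>i\<^sup>2, (C G)\<^sub>i\<rangle>\<close> for every Levi-Civita connection.

  After aligning \<open>G\<^sup>\<star>\<close> with the maximizer by an orthogonal polar factor, optimality against \<open>G\<^sup>\<star>\<close>
  bounds their Frobenius distance by \<open>n powr (1/4) / 5\<close>, and optimality against replacing one block bounds every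
  block error by \<open>0.17\<close>. Since \<open>\<Sum> A\<^sub>i = 0\<close>, the signal part of \<open>\<langle>V, C V\<rangle>\<close> only sees \<open>G - G\<^sup>\<star>\<close>, while
  \<open>(C G)\<^sub>i\<close> is close to \<open>n G\<^sub>i\<close>, and the second term dominates.
\<close>

section \<open>Calculus of smooth maps\<close>

text \<open>The data are abstract: tangent vectors are operators on functions of classes,
  \<open>nabla\<close> is any operator satisfying the Levi-Civita axioms for global vector fields,
  and \<open>riem_hess\<close> evaluates it on an unspecified extension of \<open>H\<close>. No
  chart is given, so the axioms are tested only on global fields induced by polynomial maps of the
  ambient matrix space, where every derivative is explicit. Left multiplication fields suffice: each
  tangent vector of \<open>ortho_prod\<close> is the value of one of them, and in YYf - (nabla_Y Y)f
  the vector nabla_Y Y is only paired with the gradient, whose value at the given point also extends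
  to such a field.

  The exponent 3/4 balances two errors. With r = n^(1/4) the noise has norm at most r^3/20 and the
  alignment error is at most r/5, so their product, which perturbs every single block, is at most
  n/100. The final estimate has room: in units of n <V,V>, half the Hessian form is at most 0.09 +
  0.05 - 0.6, whereas -0.1 is enough.\<close>

lemma Ck_on_cong:
  assumes "open U" "\<And>x. x \<in> U \<Longrightarrow> f x = g x" "Ck_on k U f"
  shows "Ck_on k U g"
  using assms(2,3)
proof (induction k arbitrary: f g)
  case 0
  then show ?case by (metis Ck_on.simps(1) continuous_on_cong)
next
  case (Suc k)
  have D: "(g has_derivative frechet_derivative f (at x)) (at x)" if "x \<in> U" for x
    using Suc.prems that assms(1)
    by (meson Ck_on.simps(2) frechet_derivative_works has_derivative_transform_within_open)
  have E: "frechet_derivative g (at x) = frechet_derivative f (at x)" if "x \<in> U" for x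
    using frechet_derivative_at[OF D[OF that]] by (rule sym)
  have "Ck_on k U (\<lambda>x. frechet_derivative g (at x) v)" for v
    using Suc.IH[of "\<lambda>x. frechet_derivative f (at x) v" "\<lambda>x. frechet_derivative g (at x) v"] E Suc.prems
    by simp
  then show ?case using D by (auto simp: differentiable_def)
qed

lemma Ck_on_subset: "Ck_on k U f \<Longrightarrow> V \<subseteq> U \<Longrightarrow> Ck_on k V f"
proof (induction k arbitrary: f)
  case 0
  then show ?case by (auto intro: continuous_on_subset)
next
  case (Suc k)
  then show ?case by (simp add: subset_iff)
qed

lemma Ck_on_local:
  assumes "\<And>x. x \<in> U \<Longrightarrow> \<exists>V. open V \<and> x \<in> V \<and> Ck_on k V f"
  shows "Ck_on k U f"
  using assms
proof (induction k arbitrary: f)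
  case 0
  have "continuous (at x within U) f" if x: "x \<in> U" for x
  proof -
    obtain V where "open V" "x \<in> V" "continuous_on V f" using 0[OF x] by auto
    then show ?thesis
      using continuous_on_eq_continuous_at continuous_at_imp_continuous_at_within by blast
  qed
  then show ?case by (simp add: continuous_on_eq_continuous_within)
next
  case (Suc k)
  have "Ck_on k U (\<lambda>x. frechet_derivative f (at x) v)" for v
  proof (rule Suc.IH)
    fix x assume "x \<in> U"
    from Suc.prems[OF this] show "\<exists>V. open V \<and> x \<in> V \<and> Ck_on k V (\<lambda>x. frechet_derivative f (at x) v)"
      by auto
  qed
  then show ?case using Suc.prems by fastforce
qed

lemma Ck_on_SucD: "Ck_on (Suc k) U f \<Longrightarrow> Ck_on k U f"
proof (induction k arbitrary: f)
  case 0
  then show ?case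
    by (simp add: continuous_at_imp_continuous_on differentiable_imp_continuous_within)
next
  case (Suc k)
  have "Ck_on k U (\<lambda>x. frechet_derivative f (at x) v)" for v
    by (rule Suc.IH) (use Suc.prems in auto)
  then show ?case using Suc.prems by simp
qed

text \<open>Replaces \<open>frechet_derivative\<close> by any explicit formula for the derivative;
  the closure properties below are inductions on \<open>k\<close> through this rule.\<close>

lemma Ck_on_SucI:
  assumes "open U" "\<And>x. x \<in> U \<Longrightarrow> (f has_derivative f' x) (at x)" "\<And>v. Ck_on k U (\<lambda>x. f' x v)"
  shows "Ck_on (Suc k) U f"
proof -
  have "Ck_on k U (\<lambda>x. frechet_derivative f (at x) v)" for v
  proof (rule Ck_on_cong[OF assms(1) _ assms(3)[of v]])
    show "f' x v = frechet_derivative f (at x) v" if "x \<in> U" for x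
      using frechet_derivative_at[OF assms(2)[OF that]] by simp
  qed
  then show ?thesis using assms(2) by (auto simp: differentiable_def)
qed

lemma Ck_on_SucE:
  assumes "Ck_on (Suc k) U f" "x \<in> U"
  shows "(f has_derivative frechet_derivative f (at x)) (at x)"
  using assms frechet_derivative_works by auto

lemma Ck_on_const: "open U \<Longrightarrow> Ck_on k U (\<lambda>x. c)"
proof (induction k arbitrary: c)
  case (Suc k)
  then show ?case by (intro Ck_on_SucI[where f' = "\<lambda>x v. 0"]) auto
qed auto

lemma Ck_on_bounded_linear_compose:
  assumes "open U" "bounded_linear h" "Ck_on k U f"
  shows "Ck_on k U (\<lambda>x. h (f x))"
  using assms(3)
proof (induction k arbitrary: f)
  case 0
  then show ?case
    using bounded_linear.continuous_on[OF assms(2)] by auto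
next
  case (Suc k)
  show ?case
    by (rule Ck_on_SucI[OF assms(1) bounded_linear.has_derivative[OF assms(2) Ck_on_SucE[OF Suc.prems]]])
       (use Suc in auto)
qed

lemma Ck_on_id: "open U \<Longrightarrow> Ck_on k U (\<lambda>x. x)"
proof (cases k)
  case (Suc k)
  assume "open U"
  then show ?thesis
    unfolding Suc by (intro Ck_on_SucI[where f' = "\<lambda>x v. v"]) (auto intro: Ck_on_const)
qed auto

lemma Ck_on_add:
  assumes "open U" "Ck_on k U f" "Ck_on k U g"
  shows "Ck_on k U (\<lambda>x. f x + g x)"
  using assms(2,3)
proof (induction k arbitrary: f g)
  case 0
  then show ?case by (auto intro: continuous_intros)
next
  case (Suc k)
  show ?case
    by (rule Ck_on_SucI[OF assms(1) has_derivative_add[OF Ck_on_SucE[OF Suc.prems(1)] Ck_on_SucE[OF Suc.prems(2)]]])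
       (use Suc in auto)
qed

lemma Ck_on_sum:
  assumes "open U" "\<And>i. i \<in> I \<Longrightarrow> Ck_on k U (f i)"
  shows "Ck_on k U (\<lambda>x. \<Sum>i\<in>I. f i x)"
  using assms(2)
proof (induction I rule: infinite_finite_induct)
  case (insert i I)
  then show ?case by (simp add: Ck_on_add[OF assms(1)])
qed (auto intro: Ck_on_const[OF assms(1)])

text \<open>The product rule leaves one factor undifferentiated in each summand, so the induction
  also needs the factors themselves at the lower order, by \<open>Ck_on_SucD\<close>.\<close>

lemma Ck_on_bilinear:
  assumes "open U" "bounded_bilinear p" "Ck_on k U f" "Ck_on k U g"
  shows "Ck_on k U (\<lambda>x. p (f x) (g x))"
  using assms(3,4)
proof (induction k arbitrary: f g)
  case 0
  then show ?case using bounded_bilinear.continuous_on[OF assms(2)] by auto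
next
  case (Suc k)
  show ?case
  proof (rule Ck_on_SucI[OF assms(1) bounded_bilinear.FDERIV[OF assms(2) Ck_on_SucE[OF Suc.prems(1)] Ck_on_SucE[OF Suc.prems(2)]]])
    show "Ck_on k U (\<lambda>x. p (f x) (frechet_derivative g (at x) v) + p (frechet_derivative f (at x) v) (g x))" for v
      using Suc.prems Ck_on_SucD[OF Suc.prems(1)] Ck_on_SucD[OF Suc.prems(2)]
      by (intro Ck_on_add[OF assms(1)] Suc.IH) auto
  qed
qed

lemma linear_eq_sum_Basis:
  fixes L :: "'a::euclidean_space \<Rightarrow> 'b::real_vector"
  assumes "linear L"
  shows "L b = (\<Sum>e\<in>Basis. (b \<bullet> e) *\<^sub>R L e)"
proof -
  have "L b = L (\<Sum>e\<in>Basis. (b \<bullet> e) *\<^sub>R e)" by (simp add: euclidean_representation)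
  also have "\<dots> = (\<Sum>e\<in>Basis. (b \<bullet> e) *\<^sub>R L e)"
    by (simp add: linear_sum[OF assms] linear_scale[OF assms])
  finally show ?thesis .
qed

text \<open>The chain rule differentiates \<open>f\<close> in a direction that varies with
  \<open>x\<close>, whereas \<open>Ck_on\<close> controls fixed directions only. Expanding the
  direction in a basis of the middle space gives a finite sum of fixed-direction derivatives with
  coefficients depending on \<open>x\<close>; this is why that space is Euclidean.\<close>

lemma Ck_on_compose:
  fixes g :: "'a::real_normed_vector \<Rightarrow> 'b::euclidean_space"
    and f :: "'b \<Rightarrow> 'c::real_normed_vector"
  assumes "open U" "open V" "g ` U \<subseteq> V" "Ck_on k V f" "Ck_on k U g"
  shows "Ck_on k U (\<lambda>x. f (g x))"
  using assms(4,5)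
proof (induction k arbitrary: f)
  case 0
  then show ?case using continuous_on_compose2 assms(3) by auto
next
  case (Suc k)
  have D: "((\<lambda>x. f (g x)) has_derivative
      (\<lambda>v. \<Sum>e\<in>Basis. (frechet_derivative g (at x) v \<bullet> e) *\<^sub>R frechet_derivative f (at (g x)) e)) (at x)"
    if "x \<in> U" for x
  proof -
    have 1: "(f has_derivative frechet_derivative f (at (g x))) (at (g x))"
      using Ck_on_SucE[OF Suc.prems(1)] that assms(3) by blast
    have "linear (frechet_derivative f (at (g x)))"
      using 1 has_derivative_linear by blast
    then have "(\<lambda>v. frechet_derivative f (at (g x)) (frechet_derivative g (at x) v)) =
        (\<lambda>v. \<Sum>e\<in>Basis. (frechet_derivative g (at x) v \<bullet> e) *\<^sub>R frechet_derivative f (at (g x)) e)"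
      using linear_eq_sum_Basis by blast
    moreover have "((\<lambda>x. f (g x)) has_derivative
        (\<lambda>v. frechet_derivative f (at (g x)) (frechet_derivative g (at x) v))) (at x)"
      using has_derivative_compose[OF Ck_on_SucE[OF Suc.prems(2) that] 1] .
    ultimately show ?thesis by (simp only:)
  qed
  show ?case
  proof (rule Ck_on_SucI[OF assms(1) D])
    fix v
    have "Ck_on k U (\<lambda>x. frechet_derivative f (at (g x)) e)" for e
      by (rule Suc.IH) (use Suc.prems Ck_on_SucD[OF Suc.prems(2)] in auto)
    moreover have "Ck_on k U (\<lambda>x. frechet_derivative g (at x) v \<bullet> e)" for e
      using Suc.prems by (intro Ck_on_bounded_linear_compose[OF assms(1) bounded_linear_inner_left]) auto
    ultimately show "Ck_on k U (\<lambda>x. \<Sum>e\<in>Basis. (frechet_derivative g (at x) v \<bullet> e) *\<^sub>R frechet_derivative f (at (g x)) e)"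
      by (intro Ck_on_sum[OF assms(1)] Ck_on_bilinear[OF assms(1) bounded_bilinear_scaleR])
  qed
qed

lemma smooth_on_cong:
  "open U \<Longrightarrow> (\<And>x. x \<in> U \<Longrightarrow> f x = g x) \<Longrightarrow> smooth_on U f \<Longrightarrow> smooth_on U g"
  unfolding smooth_on_def using Ck_on_cong by blast

lemma smooth_on_subset: "smooth_on U f \<Longrightarrow> V \<subseteq> U \<Longrightarrow> smooth_on V f"
  unfolding smooth_on_def using Ck_on_subset by blast

lemma smooth_on_local:
  "(\<And>x. x \<in> U \<Longrightarrow> \<exists>V. open V \<and> x \<in> V \<and> smooth_on V f) \<Longrightarrow> smooth_on U f"
  unfolding smooth_on_def using Ck_on_local by metis

lemma smooth_on_const: "open U \<Longrightarrow> smooth_on U (\<lambda>x. c)"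
  by (simp add: smooth_on_def Ck_on_const)

lemma smooth_on_id: "open U \<Longrightarrow> smooth_on U (\<lambda>x. x)"
  by (simp add: smooth_on_def Ck_on_id)

lemma smooth_on_bounded_linear_compose:
  "open U \<Longrightarrow> bounded_linear h \<Longrightarrow> smooth_on U f \<Longrightarrow> smooth_on U (\<lambda>x. h (f x))"
  by (simp add: smooth_on_def Ck_on_bounded_linear_compose)

lemma smooth_on_add:
  "open U \<Longrightarrow> smooth_on U f \<Longrightarrow> smooth_on U g \<Longrightarrow> smooth_on U (\<lambda>x. f x + g x)"
  by (simp add: smooth_on_def Ck_on_add)

lemma smooth_on_diff:
  fixes f :: "'a::real_normed_vector \<Rightarrow> 'b::real_normed_vector"
  assumes "open U" "smooth_on U f" "smooth_on U g"
  shows "smooth_on U (\<lambda>x. f x - g x)"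
  using smooth_on_add[OF assms(1,2) smooth_on_bounded_linear_compose[OF assms(1) _ assms(3),
    where h = "\<lambda>x. - x"]] by (simp add: bounded_linear_minus)

lemma smooth_on_sum:
  "open U \<Longrightarrow> (\<And>i. i \<in> I \<Longrightarrow> smooth_on U (f i)) \<Longrightarrow> smooth_on U (\<lambda>x. \<Sum>i\<in>I. f i x)"
  by (simp add: smooth_on_def Ck_on_sum)

lemma smooth_on_bilinear:
  "open U \<Longrightarrow> bounded_bilinear p \<Longrightarrow> smooth_on U f \<Longrightarrow> smooth_on U g \<Longrightarrow> smooth_on U (\<lambda>x. p (f x) (g x))"
  by (simp add: smooth_on_def Ck_on_bilinear)

lemma smooth_on_compose:
  fixes g :: "'a::real_normed_vector \<Rightarrow> 'b::euclidean_space"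
  shows "open U \<Longrightarrow> open V \<Longrightarrow> g ` U \<subseteq> V \<Longrightarrow> smooth_on V f \<Longrightarrow> smooth_on U g \<Longrightarrow>
    smooth_on U (\<lambda>x. f (g x))"
  by (simp add: smooth_on_def Ck_on_compose)

lemma smooth_on_has_derivative:
  "smooth_on U f \<Longrightarrow> x \<in> U \<Longrightarrow> (f has_derivative frechet_derivative f (at x)) (at x)"
  unfolding smooth_on_def using Ck_on_SucE by blast

lemma smooth_on_frechet_derivative:
  "smooth_on U f \<Longrightarrow> smooth_on U (\<lambda>x. frechet_derivative f (at x) v)"
  unfolding smooth_on_def by (metis Ck_on.simps(2))

text \<open>The same basis expansion for a direction \<open>b x\<close>. It is what makes a vector
  field applied to a smooth function smooth again.\<close>

lemma smooth_on_frechet_derivative_field: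
  fixes f :: "'a::euclidean_space \<Rightarrow> 'b::real_normed_vector"
  assumes "open U" "smooth_on U f" "smooth_on U b"
  shows "smooth_on U (\<lambda>x. frechet_derivative f (at x) (b x))"
proof (rule smooth_on_cong[OF assms(1)])
  show "smooth_on U (\<lambda>x. \<Sum>e\<in>Basis. (b x \<bullet> e) *\<^sub>R frechet_derivative f (at x) e)"
    using assms
    by (intro smooth_on_sum smooth_on_bilinear[OF _ bounded_bilinear_scaleR] smooth_on_frechet_derivative
        smooth_on_bounded_linear_compose[OF _ bounded_linear_inner_left]) auto
  show "(\<Sum>e\<in>Basis. (b x \<bullet> e) *\<^sub>R frechet_derivative f (at x) e) = frechet_derivative f (at x) (b x)"
    if "x \<in> U" for x
    using linear_eq_sum_Basis[symmetric] has_derivative_linear smooth_on_has_derivative[OF assms(2) that]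
    by blast
qed

section \<open>Matrices with the Frobenius inner product\<close>

lemma inner_matrix_eq: "(X::real^'k^'m) \<bullet> Y = (\<Sum>i\<in>UNIV. \<Sum>j\<in>UNIV. X$i$j * Y$i$j)"
  by (simp add: inner_vec_def)

lemma inner_transpose: "transpose (X::real^'k^'m) \<bullet> transpose Y = X \<bullet> Y"
  unfolding inner_matrix_eq transpose_def by (simp add: sum.swap[of "\<lambda>i j. X$i$j * Y$i$j"])

lemma norm_transpose: "norm (transpose (X::real^'k^'m)) = norm X"
  by (simp add: norm_eq_sqrt_inner inner_transpose)

lemma inner_matrix_mult_left:
  "((A::real^'k^'m) ** X) \<bullet> Y = (X::real^'p^'k) \<bullet> (transpose A ** Y)"
proof -
  have "(A ** X) \<bullet> Y = (\<Sum>i\<in>UNIV. \<Sum>j\<in>UNIV. \<Sum>l\<in>UNIV. A$i$l * X$l$j * Y$i$j)"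
    by (simp add: inner_matrix_eq matrix_matrix_mult_def sum_distrib_right)
  also have "\<dots> = (\<Sum>i\<in>UNIV. \<Sum>l\<in>UNIV. \<Sum>j\<in>UNIV. A$i$l * X$l$j * Y$i$j)"
    by (intro sum.cong refl sum.swap)
  also have "\<dots> = (\<Sum>l\<in>UNIV. \<Sum>i\<in>UNIV. \<Sum>j\<in>UNIV. A$i$l * X$l$j * Y$i$j)"
    by (rule sum.swap)
  also have "\<dots> = (\<Sum>l\<in>UNIV. \<Sum>j\<in>UNIV. \<Sum>i\<in>UNIV. A$i$l * X$l$j * Y$i$j)"
    by (intro sum.cong refl sum.swap)
  also have "\<dots> = X \<bullet> (transpose A ** Y)"
    by (simp add: inner_matrix_eq matrix_matrix_mult_def transpose_def sum_distrib_left mult.assoc mult.left_commute)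
  finally show ?thesis .
qed

lemma inner_matrix_mult_right:
  "((X::real^'k^'m) ** A) \<bullet> Y = X \<bullet> (Y ** transpose (A::real^'p^'k))"
proof -
  have "(X ** A) \<bullet> Y = transpose (X ** A) \<bullet> transpose Y" by (simp add: inner_transpose)
  also have "\<dots> = transpose X \<bullet> (A ** transpose Y)"
    by (simp add: matrix_transpose_mul inner_matrix_mult_left)
  also have "\<dots> = X \<bullet> (Y ** transpose A)"
    by (subst inner_transpose[symmetric]) (simp add: matrix_transpose_mul)
  finally show ?thesis .
qed

lemma trace_transpose_mult: "trace (transpose (X::real^'k^'m) ** Y) = X \<bullet> Y"
  unfolding trace_def inner_matrix_eq matrix_matrix_mult_def transpose_def
  by (simp add: sum.swap[of "\<lambda>i j. X$j$i * Y$j$i"])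

lemma norm_matrix_mult_le: "norm ((A::real^'k^'m) ** (B::real^'p^'k)) \<le> norm A * norm B"
proof -
  have e: "(A ** B)$i$j = row i A \<bullet> column j B" for i j
    by (simp add: matrix_matrix_mult_def row_def column_def inner_vec_def)
  have "(norm (A ** B))\<^sup>2 = (\<Sum>i\<in>UNIV. \<Sum>j\<in>UNIV. (row i A \<bullet> column j B)\<^sup>2)"
    unfolding power2_norm_eq_inner by (simp add: inner_matrix_eq power2_eq_square e)
  also have "\<dots> \<le> (\<Sum>i\<in>UNIV. \<Sum>j\<in>UNIV. (row i A \<bullet> row i A) * (column j B \<bullet> column j B))"
    by (intro sum_mono Cauchy_Schwarz_ineq)
  also have "\<dots> = (\<Sum>i\<in>UNIV. row i A \<bullet> row i A) * (\<Sum>j\<in>UNIV. column j B \<bullet> column j B)"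
    by (simp add: sum_product)
  also have "(\<Sum>i\<in>UNIV. row i A \<bullet> row i A) = A \<bullet> A"
    by (simp add: inner_vec_def row_def)
  also have "(\<Sum>j\<in>UNIV. column j B \<bullet> column j B) = B \<bullet> B"
    by (simp add: inner_vec_def column_def) (rule sum.swap)
  finally have "(norm (A ** B))\<^sup>2 \<le> (norm A * norm B)\<^sup>2"
    by (simp add: power2_norm_eq_inner power_mult_distrib)
  then show ?thesis by (rule power2_le_imp_le) simp
qed

lemma bounded_bilinear_matrix_mult:
  "bounded_bilinear (\<lambda>(A::real^'k^'m) (B::real^'p^'k). A ** B)"
proof (unfold_locales)
  show "\<exists>K. \<forall>(A::real^'k^'m) (B::real^'p^'k). norm (A ** B) \<le> norm A * norm B * K"
    by (rule exI[of _ 1]) (simp add: norm_matrix_mult_le)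
qed (auto simp: vec_eq_iff matrix_matrix_mult_def algebra_simps sum.distrib sum_distrib_left)

lemmas matrix_mult_linear_simps =
  bounded_bilinear.add_left[OF bounded_bilinear_matrix_mult]
  bounded_bilinear.add_right[OF bounded_bilinear_matrix_mult]
  bounded_bilinear.diff_left[OF bounded_bilinear_matrix_mult]
  bounded_bilinear.diff_right[OF bounded_bilinear_matrix_mult]
  bounded_bilinear.minus_left[OF bounded_bilinear_matrix_mult]
  bounded_bilinear.minus_right[OF bounded_bilinear_matrix_mult]
  bounded_bilinear.scaleR_left[OF bounded_bilinear_matrix_mult]
  bounded_bilinear.scaleR_right[OF bounded_bilinear_matrix_mult]
  bounded_bilinear.zero_left[OF bounded_bilinear_matrix_mult]
  bounded_bilinear.zero_right[OF bounded_bilinear_matrix_mult]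

lemma bounded_linear_transpose: "bounded_linear (transpose :: real^'k^'m \<Rightarrow> real^'m^'k)"
  by (intro bounded_linear_intro[where K = 1]) (auto simp: norm_transpose, auto simp: transpose_def vec_eq_iff)

lemmas transpose_linear_simps =
  bounded_linear.linear[OF bounded_linear_transpose, THEN linear_add]
  bounded_linear.linear[OF bounded_linear_transpose, THEN linear_diff]
  bounded_linear.linear[OF bounded_linear_transpose, THEN linear_neg]
  bounded_linear.linear[OF bounded_linear_transpose, THEN linear_scale]
  bounded_linear.linear[OF bounded_linear_transpose, THEN linear_0]

lemma orthogonal_matrix_mult_transpose:
  "orthogonal_matrix (Q::real^'d^'d) \<Longrightarrow> transpose Q ** Q = mat 1"
  "orthogonal_matrix Q \<Longrightarrow> Q ** transpose Q = mat 1"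
  "orthogonal_matrix Q \<Longrightarrow> transpose Q ** (Q ** X) = X"
  "orthogonal_matrix Q \<Longrightarrow> Q ** (transpose Q ** X) = X"
  "orthogonal_matrix Q \<Longrightarrow> (Y ** Q) ** transpose Q = Y"
  "orthogonal_matrix Q \<Longrightarrow> (Y ** transpose Q) ** Q = Y"
  unfolding orthogonal_matrix_def by (simp_all add: matrix_mul_assoc) (simp_all flip: matrix_mul_assoc)

lemma inner_orthogonal_mult_left:
  "orthogonal_matrix (Q::real^'d^'d) \<Longrightarrow> (Q ** X) \<bullet> (Q ** Y) = X \<bullet> Y"
  by (simp add: inner_matrix_mult_left orthogonal_matrix_mult_transpose)

lemma inner_orthogonal_mult_right:
  "orthogonal_matrix (Q::real^'d^'d) \<Longrightarrow> (X ** Q) \<bullet> (Y ** Q) = X \<bullet> Y"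
  by (simp add: inner_matrix_mult_right orthogonal_matrix_mult_transpose)

lemma norm_orthogonal_mult_left:
  "orthogonal_matrix (Q::real^'d^'d) \<Longrightarrow> norm (Q ** X) = norm X"
  by (simp add: norm_eq_sqrt_inner inner_orthogonal_mult_left)

lemma norm_orthogonal_mult_right:
  "orthogonal_matrix (Q::real^'d^'d) \<Longrightarrow> norm (X ** Q) = norm X"
  by (simp add: norm_eq_sqrt_inner inner_orthogonal_mult_right)

lemma inner_mat_1: "(mat 1 :: real^'d^'d) \<bullet> mat 1 = real CARD('d)"
  by (simp add: inner_matrix_eq mat_def if_distrib cong: if_cong)

lemma norm_orthogonal_matrix_square:
  "orthogonal_matrix (Q::real^'d^'d) \<Longrightarrow> (norm Q)\<^sup>2 = real CARD('d)"
  using norm_orthogonal_mult_left[of Q "mat 1"] by (simp add: power2_norm_eq_inner inner_mat_1)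

text \<open>\<open>A\<close> acts on each column of \<open>X\<close> separately, and the squared
  Frobenius norm is the sum of the squared column norms.\<close>

lemma op_norm_matrix_mult_le:
  "norm ((A::real^'k^'m) ** (X::real^'p^'k)) \<le> op_norm A * norm X"
proof -
  have sq: "(norm Y)\<^sup>2 = (\<Sum>j\<in>UNIV. (norm (column j Y))\<^sup>2)" for Y :: "real^'p^'q"
    unfolding power2_norm_eq_inner by (simp add: inner_vec_def column_def) (rule sum.swap)
  have c: "column j (A ** X) = A *v column j X" for j
    by (simp add: vec_eq_iff column_def matrix_matrix_mult_def matrix_vector_mult_def)
  have "(norm (A ** X))\<^sup>2 = (\<Sum>j\<in>UNIV. (norm (A *v column j X))\<^sup>2)" by (simp add: sq c)
  also have "\<dots> \<le> (\<Sum>j\<in>UNIV. (op_norm A * norm (column j X))\<^sup>2)"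
    unfolding op_norm_def
    by (intro sum_mono power_mono onorm) auto
  also have "\<dots> = (op_norm A * norm X)\<^sup>2" by (simp add: power_mult_distrib sq sum_distrib_left)
  finally show ?thesis
    by (rule power2_le_imp_le) (simp add: op_norm_def onorm_pos_le)
qed

lemma op_norm_nonneg: "0 \<le> op_norm A"
  by (simp add: op_norm_def onorm_pos_le)

subsection \<open>Blocks\<close>

definition stack :: "('n \<Rightarrow> real^'d^'d) \<Rightarrow> real^'d^('n::finite \<times> 'd::finite)" where
  "stack f = (\<chi> p b. f (fst p) $ snd p $ b)"

lemma block_stack [simp]: "block (stack f) i = f i"
  by (simp add: block_def stack_def vec_eq_iff)

lemma block_eqI: "(\<And>i. block X i = block Y i) \<Longrightarrow> X = Y"
  by (auto simp: block_def vec_eq_iff)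

lemma block_mult [simp]: "block (X ** Q) i = block X i ** (Q :: real^'d^'d)"
  by (simp add: block_def vec_eq_iff matrix_matrix_mult_def)

lemma block_linear_simps [simp]:
  "block (X + Y) i = block X i + block Y i" "block (X - Y) i = block X i - block Y i"
  "block (- X) i = - block X i" "block (r *\<^sub>R X) i = r *\<^sub>R block X i" "block 0 i = 0"
  by (simp_all add: block_def vec_eq_iff)

lemma sum_UNIV_Times:
  fixes f :: "'n::finite \<times> 'd::finite \<Rightarrow> 'a::comm_monoid_add"
  shows "(\<Sum>p\<in>UNIV. f p) = (\<Sum>i\<in>UNIV. \<Sum>a\<in>UNIV. f (i, a))"
  unfolding UNIV_Times_UNIV[symmetric] sum.cartesian_product by simp

lemma inner_block: "X \<bullet> Y = (\<Sum>i\<in>UNIV. block X i \<bullet> block Y i)"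
  unfolding inner_matrix_eq[of X] by (simp add: sum_UNIV_Times inner_matrix_eq block_def)

lemma norm_block_square: "(norm X)\<^sup>2 = (\<Sum>i\<in>UNIV. (norm (block X i))\<^sup>2)"
  unfolding power2_norm_eq_inner by (rule inner_block)

lemma norm_block_le: "norm (block X i) \<le> norm X"
proof (rule power2_le_imp_le)
  show "(norm (block X i))\<^sup>2 \<le> (norm X)\<^sup>2"
    unfolding norm_block_square[of X] by (rule member_le_sum) auto
qed simp

lemma bounded_linear_block: "bounded_linear (\<lambda>X. block X i)"
  by (intro bounded_linear_intro[where K = 1]) (auto simp: norm_block_le)

lemma bounded_linear_stack:
  fixes h :: "'n::finite \<Rightarrow> 'a::euclidean_space \<Rightarrow> real^'d^'d"
  assumes "\<And>i. bounded_linear (h i)"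
  shows "bounded_linear (\<lambda>x. stack (\<lambda>i. h i x))"
  by (rule linear_conv_bounded_linear[THEN iffD1], rule linearI)
     (auto intro!: block_eqI simp: linear_add linear_scale bounded_linear.linear assms)

lemma transpose_mult_eq_sum_block:
  "transpose X ** Y = (\<Sum>i\<in>UNIV. transpose (block X i) ** block Y i)"
  by (simp add: vec_eq_iff matrix_matrix_mult_def transpose_def sum_UNIV_Times block_def)

lemma ortho_prodD: "G \<in> ortho_prod \<Longrightarrow> orthogonal_matrix (block G i)"
  by (simp add: ortho_prod_def)

lemma ortho_prod_mult: "G \<in> ortho_prod \<Longrightarrow> orthogonal_matrix Q \<Longrightarrow> G ** Q \<in> ortho_prod"
  by (simp add: ortho_prod_def orthogonal_matrix_mul)

lemma ortho_prod_transpose_mult: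
  fixes G :: "real^'d^('n::finite \<times> 'd::finite)"
  assumes "G \<in> ortho_prod"
  shows "transpose G ** G = real CARD('n) *\<^sub>R mat 1"
  by (simp add: transpose_mult_eq_sum_block ortho_prodD[OF assms] orthogonal_matrix_mult_transpose sum_constant_scaleR del: sum_constant)

subsection \<open>Skew matrices and the Cayley transform\<close>

definition skew :: "real^'d^'d \<Rightarrow> bool" where
  "skew A \<longleftrightarrow> transpose A = - A"

lemma skewD: "skew A \<Longrightarrow> transpose A = - A"
  by (simp add: skew_def)

lemma skew_simps:
  "skew 0" "skew A \<Longrightarrow> skew B \<Longrightarrow> skew (A + B)" "skew A \<Longrightarrow> skew B \<Longrightarrow> skew (A - B)"
  "skew A \<Longrightarrow> skew (- A)" "skew A \<Longrightarrow> skew (r *\<^sub>R A)"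
  by (simp_all add: skew_def transpose_linear_simps)

lemma skew_sum: "(\<And>i. i \<in> I \<Longrightarrow> skew (f i)) \<Longrightarrow> skew (\<Sum>i\<in>I. f i)"
  by (induction I rule: infinite_finite_induct) (auto intro: skew_simps)

lemma skew_conj: "skew A \<Longrightarrow> skew (P ** A ** transpose P)"
  by (simp add: skew_def matrix_transpose_mul matrix_mul_assoc matrix_mult_linear_simps)

lemma skew_diff_transpose: "skew (X - transpose X)"
  by (simp add: skew_def transpose_linear_simps)

lemma inner_skew_mult_vec:
  assumes "skew A"
  shows "x \<bullet> (A *v x) = 0"
proof -
  have "x \<bullet> (A *v x) = (transpose A *v x) \<bullet> x" by (simp add: dot_lmul_matrix)
  also have "\<dots> = - (x \<bullet> (A *v x))"
    using assms
    by (simp add: skewD inner_commute inner_vec_def matrix_vector_mult_def sum_negf del: transpose_matrix_vector)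
  finally show ?thesis by simp
qed

definition resolvent :: "real^'d^'d \<Rightarrow> real \<Rightarrow> real^'d^'d" where
  "resolvent A t = matrix_inv (mat 1 - t *\<^sub>R A)"

text \<open>If x = tAx then x . x = t (x . Ax) = 0 for skew \<open>A\<close>. Hence the inverse
  exists for every real t, and the curves built from it live on the whole line, as
  \<open>smooth_path_in\<close> demands.\<close>

lemma resolvent_mult:
  assumes "skew A"
  shows "resolvent A t ** (mat 1 - t *\<^sub>R A) = mat 1" "(mat 1 - t *\<^sub>R A) ** resolvent A t = mat 1"
proof -
  have "x = 0" if "(mat 1 - t *\<^sub>R A) *v x = 0" for x
  proof -
    have "x = t *\<^sub>R (A *v x)"
      using that by (simp add: matrix_vector_mult_diff_rdistrib scaleR_matrix_vector_assoc)
    then have "x \<bullet> x = t * (x \<bullet> (A *v x))" by (metis inner_scaleR_right)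
    then show "x = 0" by (simp add: inner_skew_mult_vec[OF assms])
  qed
  then have "\<exists>B. B ** (mat 1 - t *\<^sub>R A) = mat 1" by (simp add: matrix_left_invertible_ker)
  then have "invertible (mat 1 - t *\<^sub>R A)" using invertible_left_inverse by blast
  then show "resolvent A t ** (mat 1 - t *\<^sub>R A) = mat 1" "(mat 1 - t *\<^sub>R A) ** resolvent A t = mat 1"
    unfolding resolvent_def by (auto simp: matrix_inv_def invertible_def intro: someI2_ex)
qed

lemma resolvent_0: "skew A \<Longrightarrow> resolvent A 0 = mat 1"
  using resolvent_mult(1)[of A 0] by simp

text \<open>Pairing R = 1 + tAR with R kills the term with the skew matrix and leaves |R|^2 = <1,
  R>. The bound is uniform in t, so the resolvent identity yields a Lipschitz estimate.\<close>

lemma norm_resolvent_le: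
  assumes "skew (A::real^'d^'d)"
  shows "norm (resolvent A t) \<le> norm (mat 1 :: real^'d^'d)"
proof -
  define R where "R = resolvent A t"
  have "(A ** R) \<bullet> R = 0"
    using inner_matrix_mult_left[of A R R] assms
    by (simp add: skewD matrix_mult_linear_simps inner_commute)
  moreover have 1: "R = mat 1 + t *\<^sub>R (A ** R)"
    using resolvent_mult(2)[OF assms, of t] by (simp add: R_def matrix_mult_linear_simps algebra_simps)
  ultimately have "R \<bullet> R = mat 1 \<bullet> R"
    by (metis add.right_neutral inner_add_left inner_scaleR_left mult_zero_right)
  then have "(norm R)\<^sup>2 \<le> norm (mat 1 :: real^'d^'d) * norm R"
    by (metis norm_cauchy_schwarz power2_norm_eq_inner)
  then show ?thesis unfolding R_def by (cases "resolvent A t = 0") (simp_all add: power2_eq_square mult_le_cancel_right)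
qed

lemma resolvent_identity:
  assumes "skew A"
  shows "resolvent A s - resolvent A t = (s - t) *\<^sub>R (resolvent A s ** A ** resolvent A t)"
proof -
  let ?R = "resolvent A"
  have "?R s ** (mat 1 - t *\<^sub>R A) ** ?R t - ?R s ** (mat 1 - s *\<^sub>R A) ** ?R t
      = (s - t) *\<^sub>R (?R s ** A ** ?R t)"
    by (simp add: matrix_mult_linear_simps algebra_simps)
  moreover have "?R s ** (mat 1 - t *\<^sub>R A) ** ?R t = ?R s"
    by (simp add: resolvent_mult[OF assms] flip: matrix_mul_assoc)
  ultimately show ?thesis by (simp add: resolvent_mult[OF assms])
qed

text \<open>Caratheodory's criterion. For the resolvent, the required factor of s - t is read off
  from \<open>resolvent_identity\<close>.\<close>

lemma has_vector_derivative_quotientI: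
  fixes f :: "real \<Rightarrow> 'a::real_normed_vector"
  assumes "\<And>s. f s - f t = (s - t) *\<^sub>R g s" "isCont g t"
  shows "(f has_vector_derivative g t) (at t)"
proof -
  have "((\<lambda>s. norm (g s - g t)) \<longlongrightarrow> 0) (at t)"
    using assms(2) by (simp add: isCont_def LIM_zero tendsto_norm_zero)
  moreover have "\<forall>\<^sub>F s in at t. norm (g s - g t) = norm (f s - f t - (s - t) *\<^sub>R g t) / norm (s - t)"
    using eventually_neq_at_within[of t t UNIV]
    by eventually_elim (simp add: assms(1) flip: scaleR_diff_right)
  ultimately have "((\<lambda>s. norm (f s - f t - (s - t) *\<^sub>R g t) / norm (s - t)) \<longlongrightarrow> 0) (at t)"
    by (rule Lim_transform_eventually)
  then show ?thesis
    by (simp add: has_vector_derivative_def has_derivative_iff_norm bounded_linear_scaleR_left)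
qed

lemma continuous_resolvent:
  assumes "skew (A::real^'d^'d)"
  shows "isCont (resolvent A) t"
proof -
  let ?c = "norm (mat 1 :: real^'d^'d)"
  have "norm (resolvent A s - resolvent A t) \<le> \<bar>s - t\<bar> * (?c * norm A * ?c)" for s
  proof -
    have "norm (resolvent A s ** A ** resolvent A t) \<le> norm (resolvent A s ** A) * norm (resolvent A t)"
      by (rule norm_matrix_mult_le)
    also have "\<dots> \<le> norm (resolvent A s) * norm A * norm (resolvent A t)"
      by (intro mult_right_mono norm_matrix_mult_le) auto
    also have "\<dots> \<le> ?c * norm A * ?c"
      by (intro mult_mono norm_resolvent_le assms) auto
    finally show ?thesis by (simp add: resolvent_identity[OF assms, of s t] mult_left_mono)
  qed
  then have B: "\<forall>\<^sub>F s in at t. norm (resolvent A s - resolvent A t) \<le> \<bar>s - t\<bar> * (?c * norm A * ?c)"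
    by (intro always_eventually allI)
  have "((\<lambda>s. \<bar>s - t\<bar> * (?c * norm A * ?c)) \<longlongrightarrow> \<bar>t - t\<bar> * (?c * norm A * ?c)) (at t)"
    by (intro tendsto_intros)
  then have "((\<lambda>s. \<bar>s - t\<bar> * (?c * norm A * ?c)) \<longlongrightarrow> 0) (at t)" by simp
  then have "((\<lambda>s. resolvent A s - resolvent A t) \<longlongrightarrow> 0) (at t)"
    by (rule Lim_null_comparison[OF B])
  then show ?thesis by (simp add: isCont_def LIM_zero_iff)
qed

lemma has_vector_derivative_resolvent:
  assumes "skew A"
  shows "(resolvent A has_vector_derivative resolvent A t ** A ** resolvent A t) (at t)"
proof (rule has_vector_derivative_quotientI[where g = "\<lambda>s. resolvent A s ** A ** resolvent A t"])
  show "isCont (\<lambda>s. resolvent A s ** A ** resolvent A t) t"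
    by (intro bounded_bilinear.isCont[OF bounded_bilinear_matrix_mult] continuous_resolvent assms) auto
qed (rule resolvent_identity[OF assms])

text \<open>The derivative RAR is a polynomial in R, so each order of smoothness of R gives the
  next.\<close>

lemma smooth_on_resolvent:
  assumes "skew A"
  shows "smooth_on UNIV (resolvent A)"
  unfolding smooth_on_def
proof
  show "Ck_on k UNIV (resolvent A)" for k
  proof (induction k)
    case 0
    then show ?case by (simp add: continuous_at_imp_continuous_on continuous_resolvent assms)
  next
    case (Suc k)
    have "Ck_on k UNIV (\<lambda>t. v *\<^sub>R (resolvent A t ** A ** resolvent A t))" for v
      by (intro Ck_on_bounded_linear_compose[OF open_UNIV bounded_linear_scaleR_right]
          Ck_on_bilinear[OF open_UNIV bounded_bilinear_matrix_mult] Suc Ck_on_const open_UNIV)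
    then show ?case
      by (intro Ck_on_SucI[OF open_UNIV has_vector_derivative_resolvent[OF assms, unfolded has_vector_derivative_def]])
  qed
qed

text \<open>The Cayley transform, serving in place of exp(tA): a curve of orthogonal matrices
  through the identity with velocity \<open>A\<close>, whose smoothness reduces to that of the
  resolvent.\<close>

definition cayley :: "real^'d^'d \<Rightarrow> real \<Rightarrow> real^'d^'d" where
  "cayley A t = (mat 1 + (t/2) *\<^sub>R A) ** resolvent A (t/2)"

text \<open>With B = (t/2) A, transposition exchanges 1 + B and 1 - B, and these commute, so both
  resolvents cancel.\<close>

lemma orthogonal_cayley:
  assumes "skew (A::real^'d^'d)"
  shows "orthogonal_matrix (cayley A t)"
proof -
  define R where "R = resolvent A (t/2)"
  define B where "B = (t/2) *\<^sub>R A"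
  have B: "transpose B = - B" using skewD[OF assms] by (simp add: B_def transpose_linear_simps)
  have "transpose (cayley A t) ** cayley A t = transpose R ** ((mat 1 - B) ** (mat 1 + B)) ** R"
    by (simp add: cayley_def matrix_transpose_mul transpose_linear_simps B matrix_mul_assoc flip: B_def R_def)
  also have "(mat 1 - B) ** (mat 1 + B) = (mat 1 + B) ** (mat 1 - B)"
    by (simp add: matrix_mult_linear_simps)
  also have "transpose R ** ((mat 1 + B) ** (mat 1 - B)) ** R = (transpose R ** (mat 1 + B)) ** ((mat 1 - B) ** R)"
    by (simp add: matrix_mul_assoc)
  also have "(mat 1 - B) ** R = mat 1" using resolvent_mult(2)[OF assms] by (simp add: R_def B_def)
  also have "transpose R ** (mat 1 + B) = transpose ((mat 1 - B) ** R)"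
    by (simp add: matrix_transpose_mul transpose_linear_simps B)
  also have "(mat 1 - B) ** R = mat 1" using resolvent_mult(2)[OF assms] by (simp add: R_def B_def)
  finally show ?thesis by (simp add: orthogonal_matrix)
qed

lemma cayley_0: "skew A \<Longrightarrow> cayley A 0 = mat 1"
  by (simp add: cayley_def resolvent_0)

lemma smooth_on_cayley:
  assumes "skew A"
  shows "smooth_on UNIV (cayley A)"
  unfolding cayley_def
  by (intro smooth_on_bilinear[OF open_UNIV bounded_bilinear_matrix_mult] smooth_on_add smooth_on_const open_UNIV
      smooth_on_compose[OF open_UNIV open_UNIV _ smooth_on_resolvent[OF assms]]
      smooth_on_bilinear[OF open_UNIV bounded_bilinear_scaleR]
      smooth_on_bounded_linear_compose[OF open_UNIV bounded_linear_divide] smooth_on_id) auto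

lemma has_vector_derivative_cayley:
  assumes "skew A"
  shows "(cayley A has_vector_derivative A) (at 0)"
proof -
  have h: "((\<lambda>t::real. t/2) has_vector_derivative 1/2) (at 0)"
    by (auto intro!: derivative_eq_intros simp: has_real_derivative_iff_has_vector_derivative[symmetric])
  have "((\<lambda>t. resolvent A (t/2)) has_vector_derivative (1/2) *\<^sub>R A) (at 0)"
    using vector_diff_chain_at[OF h, of "resolvent A" A] has_vector_derivative_resolvent[OF assms, of 0]
    by (simp add: resolvent_0[OF assms] o_def)
  moreover have "((\<lambda>t. mat 1 + (t/2) *\<^sub>R A) has_vector_derivative (1/2) *\<^sub>R A) (at 0)"
    by (auto intro!: derivative_eq_intros simp: h)
  ultimately have "(cayley A has_vector_derivative
     (mat 1 + (0/2) *\<^sub>R A) ** ((1/2) *\<^sub>R A) + ((1/2) *\<^sub>R A) ** resolvent A (0/2)) (at 0)"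
    unfolding cayley_def
    by (intro bounded_bilinear.has_vector_derivative[OF bounded_bilinear_matrix_mult])
  then show ?thesis by (simp add: resolvent_0[OF assms] flip: scaleR_add_left)
qed

section \<open>The quotient manifold\<close>

lemma continuous_on_smooth_on: "smooth_on U f \<Longrightarrow> continuous_on U f"
  unfolding smooth_on_def by (metis Ck_on.simps(1))

text \<open>The linear-algebra form of the tangent space of \<open>ortho_prod\<close>: V_i = G_i A_i
  with A_i skew. The agreement with velocities of curves is
  \<open>embedded_tangent_ortho_prod\<close>.\<close>

definition tangent_at :: "real^'d^('n::finite \<times> 'd::finite) \<Rightarrow> (real^'d^('n \<times> 'd)) set" where
  "tangent_at G = {V. \<forall>i. skew (transpose (block G i) ** block V i)}"

lemma tangent_atD: "V \<in> tangent_at G \<Longrightarrow> skew (transpose (block G i) ** block V i)"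
  by (simp add: tangent_at_def)

lemma tangent_at_linear:
  "V \<in> tangent_at G \<Longrightarrow> W \<in> tangent_at G \<Longrightarrow> V + W \<in> tangent_at G"
  "V \<in> tangent_at G \<Longrightarrow> W \<in> tangent_at G \<Longrightarrow> V - W \<in> tangent_at G"
  "V \<in> tangent_at G \<Longrightarrow> r *\<^sub>R V \<in> tangent_at G"
  by (simp_all add: tangent_at_def matrix_mult_linear_simps skew_simps)

lemma tangent_at_vertical: "G \<in> ortho_prod \<Longrightarrow> skew A \<Longrightarrow> G ** A \<in> tangent_at G"
  by (simp add: tangent_at_def orthogonal_matrix_mult_transpose ortho_prodD)

lemma tangent_at_mult:
  assumes "V \<in> tangent_at G" "orthogonal_matrix Q"
  shows "V ** Q \<in> tangent_at (G ** Q)"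
proof -
  have "skew (transpose Q ** (transpose (block G i) ** block V i) ** transpose (transpose Q))" for i
    using tangent_atD[OF assms(1)] by (rule skew_conj)
  then show ?thesis by (simp add: tangent_at_def matrix_transpose_mul matrix_mul_assoc)
qed

lemma skew_transpose_mult_tangent:
  "V \<in> tangent_at G \<Longrightarrow> skew (transpose G ** V)"
  unfolding transpose_mult_eq_sum_block by (intro skew_sum) (simp add: tangent_at_def)

lemma block_tangent:
  "G \<in> ortho_prod \<Longrightarrow> block V i = block G i ** (transpose (block G i) ** block V i)"
  by (simp add: orthogonal_matrix_mult_transpose ortho_prodD)

definition cayley_path ::
    "real^'d^('n::finite \<times> 'd::finite) \<Rightarrow> real^'d^('n \<times> 'd) \<Rightarrow> real \<Rightarrow> real^'d^('n \<times> 'd)" where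
  "cayley_path G V t = stack (\<lambda>i. block G i ** cayley (transpose (block G i) ** block V i) t)"

text \<open>Stacking becomes a finite sum of bounded linear embeddings of single blocks, so
  smoothness and derivatives can be checked block by block.\<close>

lemma stack_eq_sum:
  "stack f = (\<Sum>i\<in>UNIV. stack (\<lambda>j. if j = i then f i else 0))"
proof (rule block_eqI)
  fix j
  have "block (\<Sum>i\<in>UNIV. stack (\<lambda>j. if j = i then f i else 0)) j = (\<Sum>i\<in>UNIV. if j = i then f i else 0)"
    by (simp add: linear_sum[OF bounded_linear.linear[OF bounded_linear_block]])
  then show "block (stack f) j = block (\<Sum>i\<in>UNIV. stack (\<lambda>j. if j = i then f i else 0)) j"
    by simp
qed

lemma bounded_linear_stack_single:
  "bounded_linear (\<lambda>x. stack (\<lambda>j. if j = i then (x::real^'d^'d) else 0) :: real^'d^('n::finite \<times> 'd::finite))"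
proof (rule bounded_linear_stack)
  show "bounded_linear (\<lambda>x::real^'d^'d. if j = i then x else 0)" for j
    by (cases "j = i") (simp_all add: bounded_linear_ident bounded_linear_zero)
qed

lemma smooth_on_stack:
  assumes "open U" "\<And>i. smooth_on U (f i)"
  shows "smooth_on U (\<lambda>x. stack (\<lambda>i. f i x))"
  by (subst stack_eq_sum)
     (intro smooth_on_sum smooth_on_bounded_linear_compose[OF _ bounded_linear_stack_single] assms)

lemma has_vector_derivative_stack:
  assumes "\<And>i. (f i has_vector_derivative f' i) F"
  shows "((\<lambda>x. stack (\<lambda>i. f i x)) has_vector_derivative stack f') F"
  by (subst (1 2) stack_eq_sum)
     (intro has_vector_derivative_sum bounded_linear.has_vector_derivative[OF bounded_linear_stack_single] assms)

lemma cayley_path: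
  assumes "G \<in> ortho_prod" "V \<in> tangent_at G"
  shows "smooth_path_in ortho_prod (cayley_path G V)" "cayley_path G V 0 = G"
    "(cayley_path G V has_vector_derivative V) (at 0)"
proof -
  note sk = tangent_atD[OF assms(2)] and bl = bounded_bilinear.bounded_linear_right[OF bounded_bilinear_matrix_mult]
  show "cayley_path G V 0 = G"
    by (rule block_eqI) (simp add: cayley_path_def cayley_0 sk)
  have "cayley_path G V t \<in> ortho_prod" for t
    using assms(1) by (simp add: ortho_prod_def cayley_path_def orthogonal_matrix_mul orthogonal_cayley sk)
  moreover have "smooth_on UNIV (cayley_path G V)"
    unfolding cayley_path_def
    by (intro smooth_on_stack smooth_on_bounded_linear_compose[OF _ bl] smooth_on_cayley sk open_UNIV)
  ultimately show "smooth_path_in ortho_prod (cayley_path G V)" by (simp add: smooth_path_in_def)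
  have "(cayley_path G V has_vector_derivative
      stack (\<lambda>i. block G i ** (transpose (block G i) ** block V i))) (at 0)"
    unfolding cayley_path_def
    by (intro has_vector_derivative_stack bounded_linear.has_vector_derivative[OF bl]
        has_vector_derivative_cayley sk)
  moreover have "stack (\<lambda>i. block G i ** (transpose (block G i) ** block V i)) = V"
    by (rule block_eqI) (simp add: block_tangent[OF assms(1), symmetric])
  ultimately show "(cayley_path G V has_vector_derivative V) (at 0)" by simp
qed

text \<open>Differentiating X_i^T X_i = 1 gives skewness; conversely the Cayley path realises every
  skew direction.\<close>

lemma embedded_tangent_ortho_prod:
  fixes G :: "real^'d^('n::finite \<times> 'd::finite)"
  assumes "G \<in> ortho_prod"
  shows "embedded_tangent ortho_prod G = tangent_at G"
proof
  show "tangent_at G \<subseteq> embedded_tangent ortho_prod G"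
    unfolding embedded_tangent_def using cayley_path[OF assms] by blast
  show "embedded_tangent ortho_prod G \<subseteq> tangent_at G"
  proof
    fix V assume "V \<in> embedded_tangent ortho_prod G"
    then obtain \<gamma> where \<gamma>: "smooth_path_in ortho_prod \<gamma>" "\<gamma> 0 = G" "(\<gamma> has_vector_derivative V) (at 0)"
      unfolding embedded_tangent_def by blast
    have "skew (transpose (block G i) ** block V i)" for i
    proof -
      have b: "((\<lambda>t. block (\<gamma> t) i) has_vector_derivative block V i) (at 0)"
        by (rule bounded_linear.has_vector_derivative[OF bounded_linear_block \<gamma>(3)])
      have "((\<lambda>t. transpose (block (\<gamma> t) i) ** block (\<gamma> t) i) has_vector_derivative
          transpose (block (\<gamma> 0) i) ** block V i + transpose (block V i) ** block (\<gamma> 0) i) (at 0)"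
        by (intro bounded_bilinear.has_vector_derivative[OF bounded_bilinear_matrix_mult] b
            bounded_linear.has_vector_derivative[OF bounded_linear_transpose])
      moreover have "(\<lambda>t. transpose (block (\<gamma> t) i) ** block (\<gamma> t) i) = (\<lambda>t. mat 1)"
        using \<gamma>(1) by (auto simp: smooth_path_in_def ortho_prod_def orthogonal_matrix_mult_transpose)
      ultimately have "((\<lambda>t. mat 1) has_vector_derivative
          transpose (block (\<gamma> 0) i) ** block V i + transpose (block V i) ** block (\<gamma> 0) i) (at 0)"
        by (simp only:)
      then have "transpose (block G i) ** block V i + transpose (block V i) ** block G i = 0"
        using vector_derivative_unique_at[OF _ has_vector_derivative_const] unfolding \<gamma>(2) by blast
      then show ?thesis by (simp add: skew_def matrix_transpose_mul eq_neg_iff_add_eq_0 add.commute)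
    qed
    then show "V \<in> tangent_at G" by (simp add: tangent_at_def)
  qed
qed

subsection \<open>Smooth functions and smooth curves\<close>

lemma ortho_class_mult:
  assumes "orthogonal_matrix Q"
  shows "ortho_class (G ** Q) = ortho_class G"
proof -
  have "\<exists>R. G ** P = G ** Q ** R \<and> orthogonal_matrix R" if "orthogonal_matrix P" for P
    using that assms
    by (intro exI[of _ "transpose Q ** P"])
       (simp add: orthogonal_matrix_mul orthogonal_matrix_mult_transpose flip: matrix_mul_assoc)
  moreover have "\<exists>R. G ** Q ** P = G ** R \<and> orthogonal_matrix R" if "orthogonal_matrix P" for P
    using that assms by (intro exI[of _ "Q ** P"]) (simp add: orthogonal_matrix_mul flip: matrix_mul_assoc)
  ultimately show ?thesis unfolding ortho_class_def by blast
qed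

lemma ortho_class_self: "G \<in> ortho_class G"
  unfolding ortho_class_def using orthogonal_matrix_id matrix_mul_rid by (metis (mono_tags, lifting) mem_Collect_eq)

lemma some_in_ortho_class:
  obtains Q where "orthogonal_matrix Q" "(SOME X. X \<in> ortho_class G) = G ** Q"
proof -
  have "(SOME X. X \<in> ortho_class G) \<in> ortho_class G" by (rule someI) (rule ortho_class_self)
  then show ?thesis using that unfolding ortho_class_def by blast
qed

lemma ortho_class_in_quot: "G \<in> ortho_prod \<Longrightarrow> ortho_class G \<in> quot"
  by (simp add: quot_def)

text \<open>One globally smooth pullback is enough in practice: the concrete functions treated with
  it below pull back, on \<open>ortho_prod\<close>, to polynomials in the matrix entries.\<close>

lemma quot_smoothI:
  assumes "\<And>G. G \<in> ortho_prod \<Longrightarrow> F (ortho_class G) = F' G" "smooth_on UNIV F'"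
  shows "F \<in> quot_smooth"
  unfolding quot_smooth_def smooth_functions_def
  using assms by (intro CollectI ballI exI[of _ UNIV] exI[of _ F']) auto

lemma smooth_curve_ortho_class:
  assumes "smooth_path_in ortho_prod \<gamma>"
  shows "smooth_curve quot quot_smooth (\<lambda>t. ortho_class (\<gamma> t))"
  unfolding smooth_curve_def
proof (intro conjI allI ballI)
  show "ortho_class (\<gamma> t) \<in> quot" for t
    using assms by (simp add: smooth_path_in_def ortho_class_in_quot)
next
  have \<gamma>: "smooth_on UNIV \<gamma>" "\<And>t. \<gamma> t \<in> ortho_prod" using assms by (auto simp: smooth_path_in_def)
  fix F :: "(real^'a^('b \<times> 'a)) set \<Rightarrow> real" assume F: "F \<in> quot_smooth"
  show "smooth_on UNIV (\<lambda>t. F (ortho_class (\<gamma> t)))"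
  proof (rule smooth_on_local)
    fix t
    obtain U F' where U: "open U" "\<gamma> t \<in> U" "smooth_on U F'" "\<And>y. y \<in> U \<inter> ortho_prod \<Longrightarrow> F (ortho_class y) = F' y"
      using F \<gamma>(2)[of t] unfolding quot_smooth_def smooth_functions_def by blast
    have op: "open (\<gamma> -` U)"
      by (rule open_vimage[OF U(1) continuous_on_smooth_on[OF \<gamma>(1)]])
    have "smooth_on (\<gamma> -` U) (\<lambda>t. F' (\<gamma> t))"
      by (rule smooth_on_compose[OF op U(1) _ U(3)]) (auto intro: smooth_on_subset[OF \<gamma>(1)])
    then have "smooth_on (\<gamma> -` U) (\<lambda>t. F (ortho_class (\<gamma> t)))"
      by (rule smooth_on_cong[OF op, rotated]) (simp add: U(4) \<gamma>(2))
    then show "\<exists>V. open V \<and> t \<in> V \<and> smooth_on V (\<lambda>t. F (ortho_class (\<gamma> t)))"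
      using op U(2) by (intro exI[of _ "\<gamma> -` U"]) simp
  qed
qed

text \<open>The differential of the projection at \<open>G\<close>, realised through one fixed curve
  with velocity \<open>V\<close>. By \<open>velocity_eq_push\<close> every other curve in
  \<open>ortho_prod\<close> with the same position and velocity gives the same operator.\<close>

definition push :: "real^'d^('n::finite \<times> 'd::finite) \<Rightarrow> real^'d^('n \<times> 'd) \<Rightarrow> (real^'d^('n \<times> 'd)) set tvec" where
  "push G V = velocity quot_smooth (\<lambda>t. ortho_class (cayley_path G V t))"

lemma push_not_smooth: "F \<notin> quot_smooth \<Longrightarrow> push G V F = 0"
  by (simp add: push_def velocity_def)

lemma DERIV_ortho_class_path:
  assumes "smooth_path_in ortho_prod \<gamma>" "(\<gamma> has_vector_derivative V) (at 0)" "open U" "\<gamma> 0 \<in> U"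
    and "\<And>y. y \<in> U \<inter> ortho_prod \<Longrightarrow> F (ortho_class y) = F' y" "(F' has_derivative D) (at (\<gamma> 0))"
  shows "((\<lambda>t. F (ortho_class (\<gamma> t))) has_real_derivative D V) (at 0)"
proof -
  have \<gamma>: "\<gamma> t \<in> ortho_prod" for t using assms(1) by (simp add: smooth_path_in_def)
  have op: "open (\<gamma> -` U)"
    using assms(1,3) by (simp add: smooth_path_in_def open_vimage continuous_on_smooth_on)
  have "((\<lambda>t. F' (\<gamma> t)) has_derivative (\<lambda>t. D (t *\<^sub>R V))) (at 0)"
    using has_derivative_compose[OF assms(2)[unfolded has_vector_derivative_def] assms(6)] .
  then have "((\<lambda>t. F' (\<gamma> t)) has_real_derivative D V) (at 0)"
    by (simp add: has_field_derivative_def linear_scale[OF has_derivative_linear[OF assms(6)]] mult_commute_abs)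
  then show ?thesis
    by (rule has_field_derivative_transform_within_open[OF _ op]) (use assms(4,5) \<gamma> in auto)
qed

lemma velocity_path:
  assumes "smooth_path_in ortho_prod \<gamma>" "(\<gamma> has_vector_derivative V) (at 0)" "open U" "\<gamma> 0 \<in> U"
    and "\<And>y. y \<in> U \<inter> ortho_prod \<Longrightarrow> F (ortho_class y) = F' y" "(F' has_derivative D) (at (\<gamma> 0))"
    and "F \<in> quot_smooth"
  shows "velocity quot_smooth (\<lambda>t. ortho_class (\<gamma> t)) F = D V"
  using DERIV_imp_deriv[OF DERIV_ortho_class_path[OF assms(1-6)]] assms(7) by (simp add: velocity_def)

lemma push_eq:
  assumes "G \<in> ortho_prod" "V \<in> tangent_at G" "open U" "G \<in> U"
    and "\<And>y. y \<in> U \<inter> ortho_prod \<Longrightarrow> F (ortho_class y) = F' y" "(F' has_derivative D) (at G)"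
    and "F \<in> quot_smooth"
  shows "push G V F = D V"
  unfolding push_def
  by (rule velocity_path[OF cayley_path(1,3)[OF assms(1,2)] assms(3) _ assms(5) _ assms(7)])
     (use assms(4,6) in \<open>simp_all add: cayley_path(2)[OF assms(1,2)]\<close>)

lemma local_extension:
  assumes "F \<in> quot_smooth" "G \<in> ortho_prod"
  obtains U F' where "open U" "G \<in> U" "smooth_on U F'"
    "\<And>y. y \<in> U \<inter> ortho_prod \<Longrightarrow> F (ortho_class y) = F' y"
    "(F' has_derivative frechet_derivative F' (at G)) (at G)"
proof -
  obtain U F' where U: "open U" "G \<in> U" "smooth_on U F'" "\<And>y. y \<in> U \<inter> ortho_prod \<Longrightarrow> F (ortho_class y) = F' y"
    using assms unfolding quot_smooth_def smooth_functions_def by blast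
  show thesis using that[OF U smooth_on_has_derivative[OF U(3,2)]] by simp
qed

lemma velocity_eq_push:
  assumes "smooth_path_in ortho_prod \<gamma>" "(\<gamma> has_vector_derivative V) (at 0)" "\<gamma> 0 = G"
  shows "velocity quot_smooth (\<lambda>t. ortho_class (\<gamma> t)) = push G V"
proof
  fix F :: "(real^'a^('b \<times> 'a)) set \<Rightarrow> real"
  have G: "G \<in> ortho_prod" using assms by (auto simp: smooth_path_in_def)
  have V: "V \<in> tangent_at G"
    using assms unfolding embedded_tangent_ortho_prod[OF G, symmetric] embedded_tangent_def by blast
  show "velocity quot_smooth (\<lambda>t. ortho_class (\<gamma> t)) F = push G V F"
  proof (cases "F \<in> quot_smooth")
    case True
    obtain U F' where U: "open U" "G \<in> U"
      "\<And>y. y \<in> U \<inter> ortho_prod \<Longrightarrow> F (ortho_class y) = F' y"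
      "(F' has_derivative frechet_derivative F' (at G)) (at G)"
      by (rule local_extension[OF True G]) (rule that)
    have "velocity quot_smooth (\<lambda>t. ortho_class (\<gamma> t)) F = frechet_derivative F' (at G) V"
      using U assms(3) by (intro velocity_path[OF assms(1,2) U(1) _ U(3) _ True]) auto
    also have "\<dots> = push G V F" by (rule push_eq[OF G V U True, symmetric])
    finally show ?thesis .
  qed (simp add: velocity_def push_not_smooth)
qed

lemma push_linear:
  assumes "G \<in> ortho_prod" "F \<in> quot_smooth"
  obtains D where "linear D" "\<And>V. V \<in> tangent_at G \<Longrightarrow> push G V F = D V"
proof -
  obtain U F' where U: "open U" "G \<in> U"
      "\<And>y. y \<in> U \<inter> ortho_prod \<Longrightarrow> F (ortho_class y) = F' y"
      "(F' has_derivative frechet_derivative F' (at G)) (at G)"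
    by (rule local_extension[OF assms(2,1)]) (rule that)
  show thesis by (rule that[OF has_derivative_linear[OF U(4)] push_eq[OF assms(1) _ U assms(2)]])
qed

lemma push_diff:
  assumes "G \<in> ortho_prod" "V \<in> tangent_at G" "W \<in> tangent_at G"
  shows "push G (V - W) F = push G V F - push G W F"
proof (cases "F \<in> quot_smooth")
  case True
  obtain D where "linear D" "\<And>V. V \<in> tangent_at G \<Longrightarrow> push G V F = D V"
    by (rule push_linear[OF assms(1) True]) (rule that)
  then show ?thesis using assms by (simp add: linear_diff tangent_at_linear)
qed (simp add: push_not_smooth)

lemma push_global:
  assumes "G \<in> ortho_prod" "V \<in> tangent_at G" "\<And>G. G \<in> ortho_prod \<Longrightarrow> F (ortho_class G) = F' G"
    and "smooth_on UNIV F'" "(F' has_derivative D) (at G)"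
  shows "push G V F = D V"
  by (rule push_eq[OF assms(1,2) open_UNIV UNIV_I _ assms(5) quot_smoothI[OF assms(3,4)]])
     (use assms(3) in auto)

text \<open>A path and its right translate by \<open>Q\<close> project to the same curve of
  classes.\<close>

lemma push_mult:
  assumes "G \<in> ortho_prod" "V \<in> tangent_at G" "orthogonal_matrix Q"
  shows "push (G ** Q) (V ** Q) = push G V"
proof -
  note bl = bounded_bilinear.bounded_linear_left[OF bounded_bilinear_matrix_mult]
  note c = cayley_path[OF assms(1,2)]
  have "velocity quot_smooth (\<lambda>t. ortho_class (cayley_path G V t ** Q)) = push (G ** Q) (V ** Q)"
    using c(1,2) assms(3)
    by (intro velocity_eq_push bounded_linear.has_vector_derivative[OF bl c(3)])
       (auto simp: smooth_path_in_def ortho_prod_mult intro!: smooth_on_bounded_linear_compose[OF _ bl])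
  then show ?thesis by (simp add: ortho_class_mult[OF assms(3)] push_def)
qed

text \<open>The curve \<open>G ** cayley A t\<close> has this velocity and never leaves the class of
  \<open>G\<close>.\<close>

lemma push_vertical:
  assumes "G \<in> ortho_prod" "skew A"
  shows "push G (G ** A) = zero_tvec"
proof -
  note br = bounded_bilinear.bounded_linear_right[OF bounded_bilinear_matrix_mult]
  have "velocity quot_smooth (\<lambda>t. ortho_class (G ** cayley A t)) = push G (G ** A)"
    by (intro velocity_eq_push bounded_linear.has_vector_derivative[OF br has_vector_derivative_cayley])
       (auto simp: smooth_path_in_def ortho_prod_mult orthogonal_cayley cayley_0 assms
         intro!: smooth_on_bounded_linear_compose[OF _ br] smooth_on_cayley)
  moreover have "velocity quot_smooth (\<lambda>t. ortho_class (G ** cayley A t)) = zero_tvec"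
    by (simp add: ortho_class_mult orthogonal_cayley assms velocity_def zero_tvec_def fun_eq_iff)
  ultimately show ?thesis by simp
qed

subsection \<open>A global slice\<close>

text \<open>Normalizing one block to the identity gives a global section of the projection whose
  coordinates are smooth functions on the quotient; this is what turns abstract curves and tangent
  vectors of the quotient into matrices.\<close>

definition slice :: "real^'d^('n::finite \<times> 'd::finite) \<Rightarrow> real^'d^('n \<times> 'd)" where
  "slice G = G ** transpose (block G undefined)"

lemma slice_mult: "orthogonal_matrix Q \<Longrightarrow> slice (G ** Q) = slice G"
  by (simp add: slice_def matrix_transpose_mul matrix_mul_assoc orthogonal_matrix_mult_transpose)

lemma slice_ortho_prod: "G \<in> ortho_prod \<Longrightarrow> slice G \<in> ortho_prod"
  by (simp add: slice_def ortho_prod_mult ortho_prodD)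

lemma ortho_class_slice: "G \<in> ortho_prod \<Longrightarrow> ortho_class (slice G) = ortho_class G"
  by (simp add: slice_def ortho_class_mult ortho_prodD)

lemma smooth_on_slice: "smooth_on UNIV slice"
  unfolding slice_def
  by (intro smooth_on_bilinear[OF _ bounded_bilinear_matrix_mult] smooth_on_id open_UNIV
      smooth_on_bounded_linear_compose[OF _ bounded_linear_transpose]
      smooth_on_bounded_linear_compose[OF _ bounded_linear_block])

lemma has_derivative_slice:
  "(slice has_derivative (\<lambda>V. G ** transpose (block V undefined) + V ** transpose (block G undefined))) (at G)"
  unfolding slice_def
  by (intro bounded_bilinear.FDERIV[OF bounded_bilinear_matrix_mult] has_derivative_ident
      bounded_linear.has_derivative[OF bounded_linear_transpose]
      bounded_linear.has_derivative[OF bounded_linear_block])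

text \<open>Coordinates of the section, read as functions of a class. As members of
  \<open>quot_smooth\<close> they can be fed to abstract curves and tangent vectors.\<close>

definition slice_coord :: "real^'d^('n::finite \<times> 'd::finite) \<Rightarrow> (real^'d^('n \<times> 'd)) set \<Rightarrow> real" where
  "slice_coord e q = slice (SOME X. X \<in> q) \<bullet> e"

lemma slice_some: "slice (SOME X. X \<in> ortho_class G) = slice G"
  by (metis some_in_ortho_class slice_mult)

lemma slice_coord_class: "slice_coord e (ortho_class G) = slice G \<bullet> e"
  by (simp add: slice_coord_def slice_some)

lemma smooth_on_slice_inner: "smooth_on UNIV (\<lambda>G. slice G \<bullet> e)"
  by (rule smooth_on_bounded_linear_compose[OF open_UNIV bounded_linear_inner_left smooth_on_slice])

lemma slice_coord_smooth: "slice_coord e \<in> quot_smooth"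
  by (rule quot_smoothI[OF slice_coord_class smooth_on_slice_inner])

text \<open>An abstract curve is known only through its compositions with smooth functions. The
  slice coordinates recover the slice representative as a smooth matrix curve, and multiplying by
  the fixed block of \<open>G\<close> moves its starting point from \<open>slice G\<close> to
  \<open>G\<close>.\<close>

lemma smooth_curve_lift:
  fixes G :: "real^'d^('n::finite \<times> 'd::finite)"
  assumes "smooth_curve quot quot_smooth c" "G \<in> ortho_prod" "c 0 = ortho_class G"
  obtains \<gamma> where "smooth_path_in ortho_prod \<gamma>" "\<gamma> 0 = G" "c = (\<lambda>t. ortho_class (\<gamma> t))"
proof -
  let ?s = "\<lambda>t. slice (SOME X. X \<in> c t)"
  let ?\<gamma> = "\<lambda>t. ?s t ** block G undefined"
  note bl = bounded_bilinear.bounded_linear_left[OF bounded_bilinear_matrix_mult]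
  have c: "\<exists>G'\<in>ortho_prod. c t = ortho_class G' \<and> ?s t = slice G'" for t
  proof -
    obtain G' where "G' \<in> ortho_prod" "c t = ortho_class G'"
      using assms(1) unfolding smooth_curve_def quot_def by blast
    then show ?thesis using slice_some[of G'] by auto
  qed
  have s: "?s t \<in> ortho_prod" "ortho_class (?s t) = c t" for t
    using c[of t] slice_ortho_prod ortho_class_slice by metis+
  have "smooth_on UNIV (\<lambda>t. slice_coord e (c t))" for e :: "real^'d^('n \<times> 'd)"
    using assms(1) slice_coord_smooth unfolding smooth_curve_def by blast
  then have "smooth_on UNIV (\<lambda>t. \<Sum>e\<in>Basis. slice_coord e (c t) *\<^sub>R e)"
    by (intro smooth_on_sum smooth_on_bounded_linear_compose[OF _ bounded_linear_scaleR_left] open_UNIV) auto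
  then have "smooth_on UNIV ?s"
    by (simp add: slice_coord_def euclidean_representation)
  then have "smooth_on UNIV ?\<gamma>" by (intro smooth_on_bounded_linear_compose[OF _ bl]) auto
  then have 1: "smooth_path_in ortho_prod ?\<gamma>"
    using s assms(2) by (simp add: smooth_path_in_def ortho_prod_mult ortho_prodD)
  have 2: "c = (\<lambda>t. ortho_class (?\<gamma> t))"
    using s assms(2) by (simp add: ortho_class_mult ortho_prodD)
  have "?\<gamma> 0 = slice G ** block G undefined" by (simp add: assms(3) slice_some)
  then have "?\<gamma> 0 = G" using assms(2) by (simp add: slice_def orthogonal_matrix_mult_transpose ortho_prodD)
  then show thesis using that 1 2 by blast
qed

lemma tangent_space_quot:
  assumes "G \<in> ortho_prod"
  shows "tangent_space quot quot_smooth (ortho_class G) = push G ` tangent_at G"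
proof (intro equalityI subsetI)
  fix v assume "v \<in> tangent_space quot quot_smooth (ortho_class G)"
  then obtain c where c: "smooth_curve quot quot_smooth c" "c 0 = ortho_class G" "v = velocity quot_smooth c"
    unfolding tangent_space_def by blast
  obtain \<gamma> where \<gamma>: "smooth_path_in ortho_prod \<gamma>" "\<gamma> 0 = G" "c = (\<lambda>t. ortho_class (\<gamma> t))"
    using smooth_curve_lift[OF c(1) assms c(2)] by blast
  obtain V where V: "(\<gamma> has_vector_derivative V) (at 0)"
    using smooth_on_has_derivative[of UNIV \<gamma> 0] \<gamma>(1)
      vector_derivative_works[of \<gamma> "at 0"] differentiableI unfolding smooth_path_in_def by blast
  have "V \<in> tangent_at G"
    using \<gamma> V unfolding embedded_tangent_ortho_prod[OF assms, symmetric] embedded_tangent_def by blast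
  then show "v \<in> push G ` tangent_at G" using velocity_eq_push[OF \<gamma>(1) V \<gamma>(2)] \<gamma>(3) c(3) by blast
next
  fix v assume "v \<in> push G ` tangent_at G"
  then show "v \<in> tangent_space quot quot_smooth (ortho_class G)"
    unfolding tangent_space_def push_def
    using smooth_curve_ortho_class cayley_path[OF assms] by fastforce
qed

text \<open>The kernel of the differential of the projection is vertical. If all slice coordinates
  have derivative zero along \<open>V\<close>, the derivative \<open>?W\<close> of the slice map
  vanishes, and this equation can be solved for \<open>V\<close>.\<close>

lemma push_eq_zero:
  assumes "G \<in> ortho_prod" "V \<in> tangent_at G" "push G V = zero_tvec"
  obtains A where "skew A" "V = G ** A"
proof -
  let ?W = "G ** transpose (block V undefined) + V ** transpose (block G undefined)"
  have "?W \<bullet> e = 0" for e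
  proof -
    have "push G V (slice_coord e) = ?W \<bullet> e"
      by (rule push_global[OF assms(1,2) slice_coord_class smooth_on_slice_inner])
         (rule bounded_linear.has_derivative[OF bounded_linear_inner_left has_derivative_slice])
    then show ?thesis using assms(3) by (simp add: zero_tvec_def)
  qed
  then have "?W ** block G undefined = 0"
    by (metis inner_eq_zero_iff matrix_mult_linear_simps(9))
  then have "V = G ** (- (transpose (block V undefined) ** block G undefined))"
    using assms(1)
    by (simp add: matrix_mult_linear_simps orthogonal_matrix_mult_transpose ortho_prodD matrix_mul_assoc
        eq_neg_iff_add_eq_0 add.commute)
  moreover have "- (transpose (block V undefined) ** block G undefined) = transpose (block G undefined) ** block V undefined"
    using skewD[OF tangent_atD[OF assms(2)], of undefined] by (simp add: matrix_transpose_mul)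
  ultimately show thesis using that tangent_atD[OF assms(2)] by metis
qed

subsection \<open>Horizontal lifts and the metric\<close>

text \<open>A curve inside one class projects to a constant curve, so its velocity is pushed to zero
  and \<open>push_eq_zero\<close> gives its form; Cayley curves give the converse.\<close>

lemma vertical_space_eq:
  fixes G :: "real^'d^('n::finite \<times> 'd::finite)"
  assumes "G \<in> ortho_prod"
  shows "vertical_space G = {G ** A |A. skew A}"
proof (intro equalityI subsetI)
  note br = bounded_bilinear.bounded_linear_right[OF bounded_bilinear_matrix_mult]
  fix V assume "V \<in> {G ** A |A. skew A}"
  then obtain A where A: "skew A" "V = G ** A" by blast
  have "smooth_path_in (ortho_class G) (\<lambda>t. G ** cayley A t)"
    using A by (auto simp: smooth_path_in_def ortho_class_def orthogonal_cayley
       intro!: smooth_on_bounded_linear_compose[OF _ br] smooth_on_cayley)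
  moreover have "((\<lambda>t. G ** cayley A t) has_vector_derivative V) (at 0)"
    unfolding A(2) by (rule bounded_linear.has_vector_derivative[OF br has_vector_derivative_cayley[OF A(1)]])
  ultimately show "V \<in> vertical_space G"
    unfolding vertical_space_def embedded_tangent_def using cayley_0[OF A(1)]
    by (intro CollectI exI[of _ "\<lambda>t. G ** cayley A t"]) simp
next
  fix V assume "V \<in> vertical_space G"
  then obtain \<gamma> where \<gamma>: "smooth_path_in (ortho_class G) \<gamma>" "\<gamma> 0 = G" "(\<gamma> has_vector_derivative V) (at 0)"
    unfolding vertical_space_def embedded_tangent_def by blast
  have \<gamma>': "\<exists>Q. \<gamma> t = G ** Q \<and> orthogonal_matrix Q" for t
    using \<gamma>(1) unfolding smooth_path_in_def ortho_class_def by blast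
  have p: "smooth_path_in ortho_prod \<gamma>"
    unfolding smooth_path_in_def
  proof (intro conjI allI)
    show "smooth_on UNIV \<gamma>" using \<gamma>(1) by (simp add: smooth_path_in_def)
    show "\<gamma> t \<in> ortho_prod" for t using \<gamma>'[of t] by (auto simp: ortho_prod_mult[OF assms])
  qed
  have V: "V \<in> tangent_at G"
    using p \<gamma> unfolding embedded_tangent_ortho_prod[OF assms, symmetric] embedded_tangent_def by blast
  have "ortho_class (\<gamma> t) = ortho_class G" for t
    using \<gamma>'[of t] by (auto simp: ortho_class_mult)
  then have z: "push G V = zero_tvec"
    unfolding velocity_eq_push[OF p \<gamma>(3,2), symmetric] by (simp add: velocity_def zero_tvec_def fun_eq_iff)
  obtain A where "skew A" "V = G ** A" by (rule push_eq_zero[OF assms V z])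
  then show "V \<in> {G ** A |A. skew A}" by blast
qed

lemma inner_vertical: "V \<bullet> ((G::real^'k^'m) ** A) = (transpose G ** V) \<bullet> A"
  using inner_matrix_mult_left[of G A V] by (simp add: inner_commute)

lemma horizontal_space_eq:
  assumes "G \<in> ortho_prod"
  shows "horizontal_space G = {V \<in> tangent_at G. transpose G ** V = 0}"
proof -
  have "transpose G ** V = 0" if "V \<in> tangent_at G" "\<forall>W\<in>vertical_space G. V \<bullet> W = 0" for V
  proof -
    \<comment> \<open>\<open>G ** (transpose G ** V)\<close> is itself vertical because
      \<open>transpose G ** V\<close> is skew; pairing \<open>V\<close> with it gives the squared
      norm of \<open>transpose G ** V\<close>.\<close>
    have "V \<bullet> (G ** (transpose G ** V)) = 0"
      using that skew_transpose_mult_tangent[OF that(1)] unfolding vertical_space_eq[OF assms] by blast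
    then show ?thesis by (simp only: inner_vertical[of V G] inner_eq_zero_iff)
  qed
  then show ?thesis
    unfolding horizontal_space_def embedded_tangent_ortho_prod[OF assms]
    by (auto simp: vertical_space_eq[OF assms] inner_vertical[of _ G])
qed

text \<open>Since G^T G = n 1, the matrix G G^T / n is the orthogonal projection onto the matrices
  of the form G A, and \<open>hor\<close> removes that part; on tangent vectors it is the horizontal
  projection.\<close>

definition hor :: "real^'d^('n::finite \<times> 'd::finite) \<Rightarrow> real^'d^('n \<times> 'd) \<Rightarrow> real^'d^('n \<times> 'd)" where
  "hor G V = V - G ** ((1 / real CARD('n)) *\<^sub>R (transpose G ** V))"

lemma transpose_mult_hor: "G \<in> ortho_prod \<Longrightarrow> transpose G ** hor G V = 0"
  by (simp add: hor_def matrix_mult_linear_simps matrix_mul_assoc ortho_prod_transpose_mult)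

lemma hor_tangent_at: "G \<in> ortho_prod \<Longrightarrow> V \<in> tangent_at G \<Longrightarrow> hor G V \<in> tangent_at G"
  unfolding hor_def
  by (intro tangent_at_linear tangent_at_vertical skew_simps skew_transpose_mult_tangent)

lemma hor_horizontal: "transpose G ** V = 0 \<Longrightarrow> hor G V = V"
  by (simp add: hor_def matrix_mult_linear_simps)

lemma hor_mult: "orthogonal_matrix Q \<Longrightarrow> hor (G ** Q) (V ** Q) = hor G V ** Q"
  by (simp add: hor_def matrix_transpose_mul matrix_mult_linear_simps matrix_mul_assoc
      orthogonal_matrix_mult_transpose)

lemma inner_hor:
  fixes G :: "real^'d^('n::finite \<times> 'd::finite)"
  assumes "G \<in> ortho_prod"
  shows "hor G V \<bullet> hor G W = V \<bullet> W - (1 / real CARD('n)) * ((transpose G ** V) \<bullet> (transpose G ** W))"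
proof -
  have "hor G V \<bullet> hor G W = hor G V \<bullet> W"
    unfolding hor_def[of G W] inner_diff_right inner_vertical[of _ G] transpose_mult_hor[OF assms] by simp
  also have "\<dots> = V \<bullet> W - (1 / real CARD('n)) * ((transpose G ** V) \<bullet> (transpose G ** W))"
    by (simp add: hor_def inner_diff_left inner_matrix_mult_left)
  finally show ?thesis .
qed

lemma push_hor:
  fixes G :: "real^'d^('n::finite \<times> 'd::finite)"
  assumes "G \<in> ortho_prod" "V \<in> tangent_at G"
  shows "push G (hor G V) = push G V"
proof
  have sk: "skew ((1 / real CARD('n)) *\<^sub>R (transpose G ** V))"
    by (intro skew_simps skew_transpose_mult_tangent assms)
  show "push G (hor G V) F = push G V F" for F
    using push_vertical[OF assms(1) sk]
    by (simp add: hor_def push_diff[OF assms tangent_at_vertical[OF assms(1) sk]] zero_tvec_def)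
qed

lemma push_inj:
  fixes G :: "real^'d^('n::finite \<times> 'd::finite)"
  assumes "G \<in> ortho_prod" "V \<in> tangent_at G" "W \<in> tangent_at G"
    and "transpose G ** V = 0" "transpose G ** W = 0" "push G V = push G W"
  shows "V = W"
proof -
  have z: "push G (V - W) = zero_tvec"
    using assms by (simp add: fun_eq_iff zero_tvec_def push_diff)
  obtain A where A: "V - W = G ** A"
    by (rule push_eq_zero[OF assms(1) tangent_at_linear(2)[OF assms(2,3)] z])
  have "real CARD('n) *\<^sub>R A = transpose G ** (V - W)"
    unfolding A by (simp add: matrix_mul_assoc ortho_prod_transpose_mult[OF assms(1)] matrix_mult_linear_simps)
  also have "\<dots> = 0" using assms by (simp add: matrix_mult_linear_simps)
  finally have "A = 0" by simp
  then show ?thesis using A by (simp add: matrix_mult_linear_simps)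
qed

lemma dproj_iff:
  assumes "G \<in> ortho_prod"
  shows "dproj G V v \<longleftrightarrow> V \<in> tangent_at G \<and> v = push G V"
proof
  assume "dproj G V v"
  then show "V \<in> tangent_at G \<and> v = push G V"
    unfolding dproj_def embedded_tangent_ortho_prod[OF assms, symmetric] embedded_tangent_def
    using velocity_eq_push by blast
next
  assume "V \<in> tangent_at G \<and> v = push G V"
  then show "dproj G V v"
    unfolding dproj_def using cayley_path[OF assms] by (auto simp: push_def)
qed

lemma horizontal_lift_push:
  assumes "G \<in> ortho_prod" "V \<in> tangent_at G"
  shows "horizontal_lift G (push G V) = hor G V"
  unfolding horizontal_lift_def
proof (rule the_equality)
  show "hor G V \<in> horizontal_space G \<and> dproj G (hor G V) (push G V)"
    using assms by (simp add: horizontal_space_eq dproj_iff hor_tangent_at transpose_mult_hor push_hor)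
  show "W = hor G V" if "W \<in> horizontal_space G \<and> dproj G W (push G V)" for W
    using that assms
    by (intro push_inj[of G]) (auto simp: horizontal_space_eq dproj_iff hor_tangent_at transpose_mult_hor push_hor)
qed

text \<open>The representative chosen by SOME is \<open>G ** Q\<close> for some orthogonal
  \<open>Q\<close>; the lifts there are those at \<open>G\<close> times \<open>Q\<close>, which
  leaves the Frobenius inner product unchanged.\<close>

lemma quot_metric_push:
  assumes "G \<in> ortho_prod" "V \<in> tangent_at G" "W \<in> tangent_at G"
  shows "quot_metric (ortho_class G) (push G V) (push G W) = hor G V \<bullet> hor G W"
proof -
  obtain Q where Q: "orthogonal_matrix Q" "(SOME X. X \<in> ortho_class G) = G ** Q"
    by (rule some_in_ortho_class)
  have "horizontal_lift (G ** Q) (push G X) = hor G X ** Q" if "X \<in> tangent_at G" for X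
    using horizontal_lift_push[OF ortho_prod_mult[OF assms(1) Q(1)] tangent_at_mult[OF that Q(1)]]
    by (simp add: push_mult[OF assms(1) that Q(1)] hor_mult[OF Q(1)])
  then show ?thesis using assms Q by (simp add: quot_metric_def inner_orthogonal_mult_right)
qed

section \<open>Vector fields, gradient and Hessian on the quotient\<close>

text \<open>Matrix fields that descend to the quotient: equivariance makes the pushed vector
  independent of the representative. Smoothness is asked on the whole ambient space, so such a field
  can be combined with any local extension of a function.\<close>

definition equivariant_field ::
    "(real^'d^('n::finite \<times> 'd::finite) \<Rightarrow> real^'d^('n \<times> 'd)) \<Rightarrow> bool" where
  "equivariant_field b \<longleftrightarrow> smooth_on UNIV b \<and> (\<forall>G\<in>ortho_prod. b G \<in> tangent_at G) \<and>
     (\<forall>G\<in>ortho_prod. \<forall>Q. orthogonal_matrix Q \<longrightarrow> b (G ** Q) = b G ** Q)"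

definition induced_field ::
    "(real^'d^('n::finite \<times> 'd::finite) \<Rightarrow> real^'d^('n \<times> 'd)) \<Rightarrow> (real^'d^('n \<times> 'd)) set vfield" where
  "induced_field b q = (if q \<in> quot then push (SOME X. X \<in> q) (b (SOME X. X \<in> q)) else zero_tvec)"

lemma induced_field_class:
  assumes "equivariant_field b" "G \<in> ortho_prod"
  shows "induced_field b (ortho_class G) = push G (b G)"
proof -
  obtain Q where Q: "orthogonal_matrix Q" "(SOME X. X \<in> ortho_class G) = G ** Q"
    by (rule some_in_ortho_class)
  then show ?thesis
    using assms by (simp add: induced_field_def ortho_class_in_quot equivariant_field_def push_mult)
qed

lemma induced_field_vector_field:
  assumes b: "equivariant_field b"
  shows "induced_field b \<in> vector_fields quot quot_smooth"
  unfolding vector_fields_def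
proof (intro CollectI conjI ballI allI impI)
  show "induced_field b q \<in> tangent_space quot quot_smooth q" if q: "q \<in> quot" for q
  proof -
    obtain G where G: "G \<in> ortho_prod" "q = ortho_class G" using q unfolding quot_def by blast
    then show ?thesis using b by (simp add: induced_field_class tangent_space_quot equivariant_field_def)
  qed
  show "induced_field b q = zero_tvec" if "q \<notin> quot" for q
    using that by (simp add: induced_field_def)
  fix F :: "(real^'a^('b \<times> 'a)) set \<Rightarrow> real" assume F: "F \<in> quot_smooth"
  have "\<exists>U F'. open U \<and> G \<in> U \<and> smooth_on U F' \<and>
      (\<forall>y\<in>U \<inter> ortho_prod. induced_field b (ortho_class y) F = F' y)" if G: "G \<in> ortho_prod" for G
  proof -
    obtain U F' where U: "open U" "G \<in> U" "smooth_on U F'"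
      "\<And>y. y \<in> U \<inter> ortho_prod \<Longrightarrow> F (ortho_class y) = F' y"
      by (rule local_extension[OF F G]) (rule that)
    have "smooth_on U (\<lambda>x. frechet_derivative F' (at x) (b x))"
      using b smooth_on_subset unfolding equivariant_field_def
      by (intro smooth_on_frechet_derivative_field[OF U(1,3)]) blast
    moreover have "induced_field b (ortho_class y) F = frechet_derivative F' (at y) (b y)"
      if "y \<in> U \<inter> ortho_prod" for y
    proof -
      have "push y (b y) F = frechet_derivative F' (at y) (b y)"
        using that b
        by (intro push_eq[OF _ _ U(1) _ U(4) smooth_on_has_derivative[OF U(3)] F])
           (auto simp: equivariant_field_def)
      then show ?thesis using that b by (simp add: induced_field_class)
    qed
    ultimately show ?thesis using U(1,2) by blast
  qed
  then show "(\<lambda>q. induced_field b q F) \<in> quot_smooth"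
    unfolding quot_smooth_def smooth_functions_def by simp
qed

lemma quot_smooth_cong:
  assumes "\<And>q. q \<in> quot \<Longrightarrow> F q = F' q"
  shows "F \<in> quot_smooth \<longleftrightarrow> F' \<in> quot_smooth"
proof -
  have "(\<forall>y\<in>U \<inter> ortho_prod. F (ortho_class y) = g y) \<longleftrightarrow> (\<forall>y\<in>U \<inter> ortho_prod. F' (ortho_class y) = g y)" for U g
    using assms by (auto simp: ortho_class_in_quot)
  then show ?thesis unfolding quot_smooth_def smooth_functions_def by simp
qed

text \<open>Metric compatibility differentiates expressions defined on all sets of matrices, while
  identities between them hold on \<open>quot\<close> only. Tangent vectors do not see the
  difference.\<close>

lemma tangent_vector_cong:
  assumes "v \<in> tangent_space quot quot_smooth q" "\<And>p. p \<in> quot \<Longrightarrow> F p = F' p"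
  shows "v F = v F'"
proof -
  obtain c where c: "smooth_curve quot quot_smooth c" "v = velocity quot_smooth c"
    using assms(1) unfolding tangent_space_def by blast
  have "(\<lambda>t. F (c t)) = (\<lambda>t. F' (c t))" using c(1) assms(2) by (simp add: smooth_curve_def)
  moreover have "F \<in> quot_smooth \<longleftrightarrow> F' \<in> quot_smooth" by (rule quot_smooth_cong) (rule assms(2))
  ultimately show ?thesis by (simp add: c(2) velocity_def)
qed

lemma vector_field_push:
  assumes "X \<in> vector_fields quot quot_smooth" "G \<in> ortho_prod"
  obtains V where "V \<in> tangent_at G" "X (ortho_class G) = push G V"
proof -
  have "X (ortho_class G) \<in> push G ` tangent_at G"
    using assms ortho_class_in_quot[OF assms(2)]
    unfolding vector_fields_def tangent_space_quot[OF assms(2), symmetric] by blast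
  then show thesis using that by blast
qed

subsection \<open>Quadratic functions\<close>

lemma objective_eq: "objective M G = G \<bullet> (M ** G)"
  by (simp add: objective_def trace_transpose_mult flip: matrix_mul_assoc)

lemma quot_objective_class: "quot_objective M (ortho_class G) = G \<bullet> (M ** G)"
proof -
  have "objective M ` ortho_class G = {G \<bullet> (M ** G)}"
  proof -
    have "objective M (G ** Q) = G \<bullet> (M ** G)" if "orthogonal_matrix Q" for Q
      using that by (simp add: objective_eq matrix_mul_assoc inner_orthogonal_mult_right)
    then have "objective M X = G \<bullet> (M ** G)" if "X \<in> ortho_class G" for X
      using that unfolding ortho_class_def by blast
    then show ?thesis using ortho_class_self[of G] by force
  qed
  then show ?thesis by (simp add: quot_objective_def)
qed

lemma bounded_linear_matrix_mult_right: "bounded_linear (\<lambda>X. (M::real^'k^'m) ** (X::real^'p^'k))"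
  by (rule bounded_bilinear.bounded_linear_right[OF bounded_bilinear_matrix_mult])

lemma smooth_on_bounded_linear: "bounded_linear h \<Longrightarrow> smooth_on UNIV h"
  by (rule smooth_on_bounded_linear_compose[OF open_UNIV _ smooth_on_id[OF open_UNIV]])

lemma smooth_on_inner_linear:
  assumes "bounded_linear h" "bounded_linear k"
  shows "smooth_on UNIV (\<lambda>x. h x \<bullet> k x)"
  by (intro smooth_on_bilinear[OF _ bounded_bilinear_inner] smooth_on_bounded_linear assms open_UNIV)

lemma has_derivative_inner_linear:
  assumes "bounded_linear h" "bounded_linear k"
  shows "((\<lambda>x. h x \<bullet> k x) has_derivative (\<lambda>v. h x \<bullet> k v + h v \<bullet> k x)) (at x)"
  by (intro bounded_bilinear.FDERIV[OF bounded_bilinear_inner] bounded_linear_imp_has_derivative assms)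

lemma quot_objective_smooth: "quot_objective M \<in> quot_smooth"
  by (rule quot_smoothI[OF quot_objective_class
        smooth_on_inner_linear[OF bounded_linear_ident bounded_linear_matrix_mult_right]])

lemma inner_symmetric_mult:
  "transpose M = M \<Longrightarrow> X \<bullet> (M ** Y) = (M ** X) \<bullet> (Y::real^'p^'k)"
  by (simp add: inner_matrix_mult_left)

lemma push_quot_objective:
  assumes "G \<in> ortho_prod" "V \<in> tangent_at G" "transpose M = M"
  shows "push G V (quot_objective M) = 2 * (V \<bullet> (M ** G))"
proof -
  have "push G V (quot_objective M) = G \<bullet> (M ** V) + V \<bullet> (M ** G)"
    by (rule push_global[OF assms(1,2) quot_objective_class
          smooth_on_inner_linear[OF bounded_linear_ident bounded_linear_matrix_mult_right]
          has_derivative_inner_linear[OF bounded_linear_ident bounded_linear_matrix_mult_right]])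
  then show ?thesis
    by (simp add: inner_symmetric_mult[OF assms(3), of G V] inner_commute)
qed

subsection \<open>Fields generated by left multiplication\<close>

text \<open>For skew blocks \<open>B i\<close>, the infinitesimal left action of the product of
  orthogonal groups. It commutes with right multiplication, hence descends, and is linear in
  \<open>G\<close>.\<close>

definition left_mult :: "('n \<Rightarrow> real^'d^'d) \<Rightarrow> real^'d^('n::finite \<times> 'd::finite) \<Rightarrow> real^'d^('n \<times> 'd)" where
  "left_mult B G = stack (\<lambda>i. B i ** block G i)"

lemma block_left_mult [simp]: "block (left_mult B G) i = B i ** block G i"
  by (simp add: left_mult_def)

lemma bounded_linear_left_mult: "bounded_linear (left_mult B)"
  unfolding left_mult_def
  by (intro bounded_linear_stack bounded_linear_compose[OF bounded_linear_matrix_mult_right bounded_linear_block])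

lemma left_mult_mult: "left_mult B (G ** Q) = left_mult B G ** Q"
  by (rule block_eqI) (simp add: matrix_mul_assoc)

lemma left_mult_tangent_at:
  assumes "\<And>i. skew (B i)"
  shows "left_mult B G \<in> tangent_at G"
  unfolding tangent_at_def
  using skew_conj[OF assms, of "transpose (block G _)"] by (simp add: matrix_mul_assoc)

lemma equivariant_left_mult:
  assumes "\<And>i. skew (B i)"
  shows "equivariant_field (left_mult B)"
  unfolding equivariant_field_def
  using left_mult_tangent_at[of B, OF assms] smooth_on_bounded_linear[OF bounded_linear_left_mult] left_mult_mult
  by blast

lemma inner_skew_mult: "skew B \<Longrightarrow> (B ** X) \<bullet> X = 0"
  using inner_matrix_mult_left[of B X X] by (simp add: skewD matrix_mult_linear_simps inner_commute)

lemma inner_left_mult_self: "(\<And>i. skew (B i)) \<Longrightarrow> left_mult B X \<bullet> X = 0"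
  by (simp add: inner_block inner_skew_mult)

lemma inner_left_mult_ortho_prod:
  "G \<in> ortho_prod \<Longrightarrow> left_mult B G \<bullet> left_mult B' G = (\<Sum>i\<in>UNIV. B i \<bullet> B' i)"
  by (simp add: inner_block inner_orthogonal_mult_right ortho_prodD)

text \<open>Blockwise this is <B_i B'_i, B_i>, the pairing of the skew matrix B'_i with the
  symmetric matrix B_i^T B_i. It removes a term of the Lie bracket in
  \<open>connection_left_mult_self\<close>.\<close>

lemma inner_left_mult_left_mult:
  assumes "G \<in> ortho_prod" "\<And>i. skew (B i)" "\<And>i. skew (B' i)"
  shows "left_mult B (left_mult B' G) \<bullet> left_mult B G = 0"
proof -
  have "(B i ** (B' i ** block G i)) \<bullet> (B i ** block G i) = 0" for i
  proof -
    have "(B i ** (B' i ** block G i)) \<bullet> (B i ** block G i) = (B i ** B' i) \<bullet> B i"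
      by (simp add: matrix_mul_assoc inner_orthogonal_mult_right ortho_prodD[OF assms(1)])
    also have "\<dots> = - ((B' i ** transpose (B i)) \<bullet> transpose (B i))"
      by (subst inner_transpose[symmetric])
         (simp add: matrix_transpose_mul skewD assms matrix_mult_linear_simps inner_matrix_mult_left inner_commute)
    finally show ?thesis by (simp add: inner_skew_mult assms(3))
  qed
  then show ?thesis by (simp add: inner_block)
qed

lemma push_left_mult_quot_objective:
  assumes "G \<in> ortho_prod" "V \<in> tangent_at G" "transpose M = M" "\<And>i. skew (B i)"
  shows "push G V (\<lambda>p. induced_field (left_mult B) p (quot_objective M)) =
    2 * (left_mult B V \<bullet> (M ** G) + left_mult B G \<bullet> (M ** V))"
proof -
  note bl = bounded_linear_left_mult[of B] bounded_linear_matrix_mult_right[of M]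
  note e = equivariant_left_mult[of B, OF assms(4)]
  show ?thesis
  proof (rule push_global[OF assms(1,2), where F' = "\<lambda>G. 2 * (left_mult B G \<bullet> (M ** G))"])
    show "induced_field (left_mult B) (ortho_class G) (quot_objective M) = 2 * (left_mult B G \<bullet> (M ** G))"
      if "G \<in> ortho_prod" for G
      using that e by (simp add: induced_field_class push_quot_objective assms left_mult_tangent_at)
    show "smooth_on UNIV (\<lambda>G. 2 * (left_mult B G \<bullet> (M ** G)))"
      by (intro smooth_on_bounded_linear_compose[OF open_UNIV bounded_linear_mult_right] smooth_on_inner_linear bl)
    have "((\<lambda>G. 2 * (left_mult B G \<bullet> (M ** G))) has_derivative
        (\<lambda>V. 2 * (left_mult B G \<bullet> (M ** V) + left_mult B V \<bullet> (M ** G)))) (at G)"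
      by (intro bounded_linear.has_derivative[OF bounded_linear_mult_right] has_derivative_inner_linear bl)
    then show "((\<lambda>G. 2 * (left_mult B G \<bullet> (M ** G))) has_derivative
        (\<lambda>V. 2 * (left_mult B V \<bullet> (M ** G) + left_mult B G \<bullet> (M ** V)))) (at G)"
      by (simp add: add.commute)
  qed
qed

text \<open>The metric of two such fields is constant up to a product of two terms vanishing at \<open>G\<close>.\<close>

lemma push_metric_left_mult:
  fixes G :: "real^'d^('n::finite \<times> 'd::finite)"
  assumes "G \<in> ortho_prod" "V \<in> tangent_at G" "\<And>i. skew (B i)" "\<And>i. skew (B' i)"
    and "transpose G ** left_mult B G = 0" "transpose G ** left_mult B' G = 0"
  shows "push G V (\<lambda>p. quot_metric p (induced_field (left_mult B) p) (induced_field (left_mult B') p)) = 0"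
proof -
  define m where "m B G = transpose G ** left_mult B G" for B :: "'n \<Rightarrow> real^'d^'d" and G
  note e = equivariant_left_mult[of B, OF assms(3)] equivariant_left_mult[of B', OF assms(4)]
  let ?F' = "\<lambda>G. (\<Sum>i\<in>UNIV. B i \<bullet> B' i) - (1 / real CARD('n)) * (m B G \<bullet> m B' G)"
  have m: "smooth_on UNIV (m B)" for B
    unfolding m_def
    by (intro smooth_on_bilinear[OF open_UNIV bounded_bilinear_matrix_mult] smooth_on_bounded_linear
        bounded_linear_transpose bounded_linear_left_mult)
  have md: "(m B has_derivative frechet_derivative (m B) (at G)) (at G)" for B
    by (rule smooth_on_has_derivative[OF m UNIV_I])
  have "((\<lambda>G. m B G \<bullet> m B' G) has_derivative
      (\<lambda>V. m B G \<bullet> frechet_derivative (m B') (at G) V + frechet_derivative (m B) (at G) V \<bullet> m B' G)) (at G)"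
    by (rule bounded_bilinear.FDERIV[OF bounded_bilinear_inner md md])
  then have "((\<lambda>G. m B G \<bullet> m B' G) has_derivative (\<lambda>V. 0)) (at G)"
    using assms(5,6) by (simp add: m_def)
  then have "((\<lambda>G. (1 / real CARD('n)) * (m B G \<bullet> m B' G)) has_derivative (\<lambda>V. (1 / real CARD('n)) * 0)) (at G)"
    by (rule bounded_linear.has_derivative[OF bounded_linear_mult_right])
  then have D: "(?F' has_derivative (\<lambda>V. 0 - (1 / real CARD('n)) * 0)) (at G)"
    by (intro has_derivative_diff has_derivative_const)
  have S: "smooth_on UNIV ?F'"
    by (intro smooth_on_diff smooth_on_const smooth_on_bounded_linear_compose[OF open_UNIV bounded_linear_mult_right]
        smooth_on_bilinear[OF open_UNIV bounded_bilinear_inner] m open_UNIV)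
  have E: "quot_metric (ortho_class G) (induced_field (left_mult B) (ortho_class G))
      (induced_field (left_mult B') (ortho_class G)) = ?F' G" if "G \<in> ortho_prod" for G
    using that e
    by (simp add: induced_field_class quot_metric_push left_mult_tangent_at assms inner_hor
        inner_left_mult_ortho_prod m_def)
  show ?thesis using push_global[OF assms(1,2) E S D] by simp
qed

text \<open>Take B_i = V_i G_i^T. The last clause records the acceleration G_i A_i^2 of the orbit
  through \<open>G\<close>, with A_i = G_i^T V_i, which becomes the second term of the
  Hessian.\<close>

lemma ex_left_mult_tangent:
  assumes "G \<in> ortho_prod" "V \<in> tangent_at G"
  shows "\<exists>B. (\<forall>i. skew (B i)) \<and> left_mult B G = V \<and>
    left_mult B V = stack (\<lambda>i. block V i ** (transpose (block G i) ** block V i))"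
proof (intro exI conjI allI)
  let ?B = "\<lambda>i. block V i ** transpose (block G i)"
  have "skew (block G i ** (transpose (block G i) ** block V i) ** transpose (block G i))" for i
    using tangent_atD[OF assms(2)] by (rule skew_conj)
  then show "skew (?B i)" for i
    by (simp add: orthogonal_matrix_mult_transpose ortho_prodD[OF assms(1)])
  show "left_mult ?B G = V"
    by (rule block_eqI) (simp add: orthogonal_matrix_mult_transpose ortho_prodD[OF assms(1)])
  show "left_mult ?B V = stack (\<lambda>i. block V i ** (transpose (block G i) ** block V i))"
    by (rule block_eqI) (simp add: matrix_mul_assoc)
qed

subsection \<open>The gradient\<close>

text \<open>At orthogonal blocks, block i is G_i (S - S^T) with S = G_i^T (C G)_i: twice the
  tangential projection of C G, as expected for the gradient of a quadratic form.\<close>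

definition grad_lift ::
    "real^('n \<times> 'd)^('n \<times> 'd) \<Rightarrow> real^'d^('n::finite \<times> 'd::finite) \<Rightarrow> real^'d^('n \<times> 'd)" where
  "grad_lift C G = C ** G - stack (\<lambda>i. block G i ** (transpose (block (C ** G) i) ** block G i))"

lemma equivariant_grad_lift:
  fixes C :: "real^('n::finite \<times> 'd::finite)^('n \<times> 'd)"
  shows "equivariant_field (grad_lift C)"
  unfolding equivariant_field_def
proof (intro conjI ballI allI impI)
  show "smooth_on UNIV (grad_lift C)"
    unfolding grad_lift_def
    by (intro smooth_on_diff smooth_on_stack smooth_on_bilinear[OF open_UNIV bounded_bilinear_matrix_mult]
        smooth_on_bounded_linear bounded_linear_block bounded_linear_matrix_mult_right
        smooth_on_bounded_linear_compose[OF open_UNIV bounded_linear_transpose]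
        smooth_on_bounded_linear_compose[OF open_UNIV bounded_linear_block] open_UNIV)
next
  fix G :: "real^'d^('n \<times> 'd)" assume G: "G \<in> ortho_prod"
  have "skew (X - transpose X)" for X :: "real^'d^'d" by (rule skew_diff_transpose)
  from this[of "transpose (block G _) ** block (C ** G) _"] show "grad_lift C G \<in> tangent_at G"
    using G by (simp add: tangent_at_def grad_lift_def matrix_mult_linear_simps orthogonal_matrix_mult_transpose
        ortho_prodD matrix_transpose_mul)
  show "grad_lift C (G ** Q) = grad_lift C G ** Q" if "orthogonal_matrix Q" for Q
    by (rule block_eqI)
       (use that in \<open>simp add: grad_lift_def matrix_mult_linear_simps matrix_mul_assoc matrix_transpose_mul
         orthogonal_matrix_mult_transpose\<close>)
qed

text \<open>Summing over the blocks leaves G^T C G minus its transpose, which vanishes for symmetric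
  \<open>C\<close>.\<close>

lemma grad_lift_horizontal:
  assumes "G \<in> ortho_prod" "transpose C = C"
  shows "transpose G ** grad_lift C G = 0"
proof -
  have "transpose G ** grad_lift C G = transpose G ** (C ** G) - transpose (C ** G) ** G"
    by (simp add: grad_lift_def matrix_mult_linear_simps transpose_mult_eq_sum_block[of _ "stack _"]
        orthogonal_matrix_mult_transpose ortho_prodD[OF assms(1)] transpose_mult_eq_sum_block[of "C ** G"])
  then show ?thesis by (simp add: matrix_transpose_mul assms(2) matrix_mul_assoc)
qed

text \<open>On G_i A with \<open>A\<close> skew, moving the transpose onto \<open>A\<close> shows
  that the subtracted term pairs to the negative of the first one, hence the factor 2.\<close>

lemma inner_grad_lift:
  assumes "G \<in> ortho_prod" "V \<in> tangent_at G"
  shows "grad_lift C G \<bullet> V = 2 * (V \<bullet> (C ** G))"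
proof -
  have "(block G i ** (transpose (block (C ** G) i) ** block G i)) \<bullet> block V i =
      - (block (C ** G) i \<bullet> block V i)" for i
  proof -
    have "(block G i ** (transpose (block (C ** G) i) ** block G i)) \<bullet> block V i =
        (transpose (block (C ** G) i) ** block G i) \<bullet> (transpose (block G i) ** block V i)"
      by (rule inner_matrix_mult_left)
    also have "\<dots> = (transpose (block G i) ** block (C ** G) i) \<bullet> transpose (transpose (block G i) ** block V i)"
      by (subst inner_transpose[symmetric]) (simp only: matrix_transpose_mul transpose_transpose)
    also have "\<dots> = - (block (C ** G) i \<bullet> (block G i ** (transpose (block G i) ** block V i)))"
      unfolding skewD[OF tangent_atD[OF assms(2)]] by (simp add: inner_matrix_mult_left)
    finally show ?thesis using block_tangent[OF assms(1), of V i] by simp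
  qed
  then have "stack (\<lambda>i. block G i ** (transpose (block (C ** G) i) ** block G i)) \<bullet> V = - ((C ** G) \<bullet> V)"
    by (simp add: inner_block sum_negf)
  then show ?thesis by (simp add: grad_lift_def inner_diff_left inner_commute[of V])
qed

lemma metric_grad_field:
  assumes "transpose C = C" "q \<in> quot" "v \<in> tangent_space quot quot_smooth q"
  shows "quot_metric q (induced_field (grad_lift C) q) v = v (quot_objective C)"
proof -
  obtain G where G: "G \<in> ortho_prod" "q = ortho_class G" using assms(2) unfolding quot_def by blast
  obtain V where V: "V \<in> tangent_at G" "v = push G V" using assms(3) G tangent_space_quot by blast
  have t: "grad_lift C G \<in> tangent_at G"
    using equivariant_grad_lift[of C] G(1) by (simp add: equivariant_field_def)
  have "quot_metric q (induced_field (grad_lift C) q) v = hor G (grad_lift C G) \<bullet> hor G V"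
    using G V t by (simp add: induced_field_class equivariant_grad_lift quot_metric_push)
  also have "\<dots> = grad_lift C G \<bullet> V"
    using G by (simp add: inner_hor grad_lift_horizontal assms(1))
  also have "\<dots> = v (quot_objective C)"
    using G V by (simp add: inner_grad_lift push_quot_objective assms(1))
  finally show ?thesis .
qed

lemma quot_metric_commute: "quot_metric q v w = quot_metric q w v"
  by (simp add: quot_metric_def Let_def inner_commute)

text \<open>\<open>riem_grad\<close> is a definite description, so uniqueness must be shown: the
  difference \<open>?D\<close> of the horizontal lifts of two candidates is an admissible test
  vector, hence orthogonal to itself. Off \<open>quot\<close> both fields are
  \<open>zero_tvec\<close>.\<close>

lemma riem_grad_quot_objective:
  fixes C :: "real^('n::finite \<times> 'd::finite)^('n \<times> 'd)"
  assumes "transpose C = C"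
  shows "riem_grad quot quot_smooth quot_metric (quot_objective C) = induced_field (grad_lift C)"
  unfolding riem_grad_def
proof (rule the_equality)
  show "induced_field (grad_lift C) \<in> vector_fields quot quot_smooth \<and>
    (\<forall>q\<in>quot. \<forall>v\<in>tangent_space quot quot_smooth q.
        quot_metric q (induced_field (grad_lift C) q) v = v (quot_objective C))"
    using metric_grad_field[OF assms] induced_field_vector_field[OF equivariant_grad_lift] by blast
  fix Z :: "(real^'d^('n \<times> 'd)) set vfield"
  assume Z: "Z \<in> vector_fields quot quot_smooth \<and>
    (\<forall>q\<in>quot. \<forall>v\<in>tangent_space quot quot_smooth q. quot_metric q (Z q) v = v (quot_objective C))"
  show "Z = induced_field (grad_lift C)"
  proof
    fix q show "Z q = induced_field (grad_lift C) q"
    proof (cases "q \<in> quot")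
      case False
      then show ?thesis using Z by (simp add: induced_field_def vector_fields_def)
    next
      case True
      then obtain G where G: "G \<in> ortho_prod" "q = ortho_class G" unfolding quot_def by blast
      obtain V where V: "V \<in> tangent_at G" "Z q = push G V"
        using vector_field_push[OF conjunct1[OF Z] G(1)] G(2) by metis
      let ?W = "grad_lift C G"
      have W: "?W \<in> tangent_at G"
        using equivariant_grad_lift[of C] G(1) by (simp add: equivariant_field_def)
      let ?D = "hor G V - hor G ?W"
      have D: "?D \<in> tangent_at G" using V W G by (intro tangent_at_linear hor_tangent_at)
      have "transpose G ** ?D = 0"
        using G by (simp add: matrix_mult_linear_simps transpose_mult_hor)
      then have hD: "hor G ?D = ?D" by (rule hor_horizontal)
      have T: "push G ?D \<in> tangent_space quot quot_smooth q"
        using G D by (simp add: tangent_space_quot)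
      have "quot_metric q (push G V) (push G ?D) = quot_metric q (push G ?W) (push G ?D)"
        using bspec[OF bspec[OF conjunct2[OF Z] True] T] V(2) metric_grad_field[OF assms True T] G
        by (simp add: induced_field_class equivariant_grad_lift)
      then have "hor G V \<bullet> ?D = hor G ?W \<bullet> ?D"
        using G V W D by (simp add: quot_metric_push hD)
      then have "?D \<bullet> ?D = 0" by (simp only: inner_diff_left)
      then have "hor G V = hor G ?W" by simp
      then have "push G V = push G ?W" using push_hor[OF G(1)] V(1) W by metis
      then show ?thesis using V G by (simp add: induced_field_class equivariant_grad_lift)
    qed
  qed
qed

subsection \<open>The Hessian\<close>

text \<open>The identity Hess f(X,Y) = XYf - (nabla_X Y)f: differentiate <grad f, Y> = Yf along
  \<open>X\<close> with metric compatibility.\<close>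

lemma connection_grad_metric:
  assumes lc: "levi_civita quot quot_smooth quot_metric nabla" and C: "transpose C = C"
    and X: "X \<in> vector_fields quot quot_smooth" and Y: "Y \<in> vector_fields quot quot_smooth"
    and q: "q \<in> quot"
  shows "quot_metric q (nabla X (induced_field (grad_lift C)) q) (Y q) =
    X q (\<lambda>p. Y p (quot_objective C)) - nabla X Y q (quot_objective C)"
proof -
  let ?Z = "induced_field (grad_lift C)"
  have Z: "?Z \<in> vector_fields quot quot_smooth"
    by (rule induced_field_vector_field[OF equivariant_grad_lift])
  have "nabla X Y \<in> vector_fields quot quot_smooth"
    using lc X Y quot_objective_smooth unfolding levi_civita_def affine_connection_def by blast
  then have T: "nabla X Y q \<in> tangent_space quot quot_smooth q" using q by (simp add: vector_fields_def)
  have "X q (\<lambda>p. quot_metric p (?Z p) (Y p)) =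
      quot_metric q (nabla X ?Z q) (Y q) + quot_metric q (?Z q) (nabla X Y q)"
    using lc X Y Z q unfolding levi_civita_def metric_compatible_def by blast
  moreover have "X q (\<lambda>p. quot_metric p (?Z p) (Y p)) = X q (\<lambda>p. Y p (quot_objective C))"
  proof (rule tangent_vector_cong[where v = "X q" and q = q])
    show "X q \<in> tangent_space quot quot_smooth q" using X q by (simp add: vector_fields_def)
    show "quot_metric p (?Z p) (Y p) = Y p (quot_objective C)" if "p \<in> quot" for p
      using that Y by (intro metric_grad_field C) (auto simp: vector_fields_def)
  qed
  ultimately show ?thesis using metric_grad_field[OF C q T] by simp
qed

text \<open>Symmetry of the Hessian allows to exchange the field chosen in \<^const>\<open>riem_hess\<close> for any
  other one with the same value at \<open>q\<close>.\<close>

lemma connection_grad_metric_extension: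
  assumes lc: "levi_civita quot quot_smooth quot_metric nabla" and C: "transpose C = C"
    and X: "X \<in> vector_fields quot quot_smooth" and Y: "Y \<in> vector_fields quot quot_smooth"
    and q: "q \<in> quot" and XY: "X q = Y q"
  shows "quot_metric q (nabla X (induced_field (grad_lift C)) q) (Y q) =
    Y q (\<lambda>p. Y p (quot_objective C)) - nabla Y Y q (quot_objective C)"
proof -
  have "nabla X Y q (quot_objective C) - nabla Y X q (quot_objective C) =
      X q (\<lambda>p. Y p (quot_objective C)) - Y q (\<lambda>p. X p (quot_objective C))"
    using lc X Y q quot_objective_smooth[of C]
    unfolding levi_civita_def torsion_free_def lie_bracket_def by metis
  then show ?thesis
    using connection_grad_metric[OF lc C X Y q] connection_grad_metric[OF lc C Y X q]
      connection_grad_metric[OF lc C Y Y q] XY by simp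
qed

text \<open>A left multiplication field is a Killing field of the quotient, and its length is critical
  at points where it is horizontal; hence its integral curve through such a point is a geodesic.\<close>

lemma connection_left_mult_self:
  fixes G :: "real^'d^('n::finite \<times> 'd::finite)"
  assumes lc: "levi_civita quot quot_smooth quot_metric nabla"
    and G: "G \<in> ortho_prod" and B: "\<And>i. skew (B i)" and B': "\<And>i. skew (B' i)"
    and h: "transpose G ** left_mult B G = 0" "transpose G ** left_mult B' G = 0"
  defines "Y \<equiv> induced_field (left_mult B)" and "W \<equiv> induced_field (left_mult B')"
    and "q \<equiv> ortho_class G"
  shows "quot_metric q (nabla Y Y q) (W q) = 0"
proof -
  note eB = equivariant_left_mult[of B, OF B] and eB' = equivariant_left_mult[of B', OF B']
  have Y: "Y \<in> vector_fields quot quot_smooth" and W: "W \<in> vector_fields quot quot_smooth"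
    unfolding Y_def W_def by (intro induced_field_vector_field eB eB')+
  have q: "q \<in> quot" by (simp add: q_def ortho_class_in_quot G)
  let ?V = "left_mult B G" and ?V' = "left_mult B' G"
  have Yq: "Y q = push G ?V" and Wq: "W q = push G ?V'"
    by (simp_all add: Y_def W_def q_def induced_field_class eB eB' G)
  have V: "?V \<in> tangent_at G" and V': "?V' \<in> tangent_at G"
    by (intro left_mult_tangent_at B B')+
  \<comment> \<open>The torsion axiom speaks of derivatives of functions, not of inner products.
    This \<open>M\<close> is chosen so that the derivative of \<open>quot_objective M\<close> at
    \<open>q\<close> is the pairing with \<open>Y q\<close>: G^T G = n 1 and ?V^T G = 0 give 2 M G =
    ?V.\<close>
  define M where "M = (1 / (2 * real CARD('n))) *\<^sub>R (?V ** transpose G + G ** transpose ?V)"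
  have Ms: "transpose M = M"
    by (simp add: M_def transpose_linear_simps matrix_transpose_mul add.commute)
  have "transpose ?V ** G = 0"
    using arg_cong[OF h(1), of transpose] by (simp add: matrix_transpose_mul transpose_linear_simps)
  then have MG: "2 *\<^sub>R (M ** G) = ?V"
    by (simp add: M_def matrix_mult_linear_simps matrix_mul_assoc[symmetric] ortho_prod_transpose_mult[OF G])
  have \<phi>: "quot_metric q v (Y q) = v (quot_objective M)" if v: "v \<in> tangent_space quot quot_smooth q" for v
  proof -
    obtain U where U: "U \<in> tangent_at G" "v = push G U"
      using v G unfolding q_def tangent_space_quot[OF G] by blast
    have "quot_metric q v (Y q) = U \<bullet> ?V"
      unfolding U(2) Yq unfolding q_def quot_metric_push[OF G U(1) V] by (simp add: inner_hor[OF G] h(1))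
    also have "\<dots> = v (quot_objective M)"
      unfolding U(2) push_quot_objective[OF G U(1) Ms] by (simp flip: MG)
    finally show ?thesis .
  qed
  have vf: "nabla Y W \<in> vector_fields quot quot_smooth" "nabla W Y \<in> vector_fields quot quot_smooth"
    using lc W Y quot_objective_smooth unfolding levi_civita_def affine_connection_def by blast+
  have 1: "Y q (\<lambda>p. quot_metric p (Y p) (W p)) =
      quot_metric q (nabla Y Y q) (W q) + quot_metric q (Y q) (nabla Y W q)"
    and 2: "W q (\<lambda>p. quot_metric p (Y p) (Y p)) =
      quot_metric q (nabla W Y q) (Y q) + quot_metric q (Y q) (nabla W Y q)"
    using lc W Y q unfolding levi_civita_def metric_compatible_def by blast+
  have 3: "nabla Y W q (quot_objective M) - nabla W Y q (quot_objective M) =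
      Y q (\<lambda>p. W p (quot_objective M)) - W q (\<lambda>p. Y p (quot_objective M))"
    using lc W Y q quot_objective_smooth[of M]
    unfolding levi_civita_def torsion_free_def lie_bracket_def by metis
  have 4: "Y q (\<lambda>p. quot_metric p (Y p) (W p)) = 0" "W q (\<lambda>p. quot_metric p (Y p) (Y p)) = 0"
    unfolding Yq Wq unfolding Y_def W_def
    by (intro push_metric_left_mult G V V' B B' h)+
  have "Y q (\<lambda>p. W p (quot_objective M)) = left_mult B' ?V \<bullet> ?V + 2 * (?V' \<bullet> (M ** ?V))"
    unfolding Yq unfolding W_def push_left_mult_quot_objective[of G _ M B', OF G V Ms B'] by (simp flip: MG)
  moreover have "W q (\<lambda>p. Y p (quot_objective M)) = left_mult B ?V' \<bullet> ?V + 2 * (?V \<bullet> (M ** ?V'))"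
    unfolding Wq unfolding Y_def push_left_mult_quot_objective[of G _ M B, OF G V' Ms B] by (simp flip: MG)
  \<comment> \<open>The two terms with \<open>M\<close> agree by symmetry; the other two vanish
    separately, one because B' is skew and one by \<open>inner_left_mult_left_mult\<close>. So the
    bracket has no component along \<open>Y q\<close>.\<close>
  ultimately have "Y q (\<lambda>p. W p (quot_objective M)) - W q (\<lambda>p. Y p (quot_objective M)) = 0"
    using inner_left_mult_self[of B' ?V, OF B'] inner_left_mult_left_mult[of G B B', OF G B B']
      inner_symmetric_mult[OF Ms, of ?V' ?V] inner_commute[of "M ** ?V'" ?V] by linarith
  moreover have "quot_metric q (nabla Y W q) (Y q) = nabla Y W q (quot_objective M)"
    "quot_metric q (nabla W Y q) (Y q) = nabla W Y q (quot_objective M)"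
    using vf q by (intro \<phi>; simp add: vector_fields_def)+
  \<comment> \<open>Koszul's argument: <nabla_Y Y, W> = -<Y, nabla_Y W> = -<Y, nabla_W Y> = -(1/2)
    W<Y,Y> = 0.\<close>
  ultimately show ?thesis
    using 1 2 3 4 quot_metric_commute[of q "Y q"] by simp
qed

theorem riem_hess_quot_objective:
  fixes G :: "real^'d^('n::finite \<times> 'd::finite)"
  assumes lc: "levi_civita quot quot_smooth quot_metric nabla" and C: "transpose C = C"
    and G: "G \<in> ortho_prod" and V: "V \<in> tangent_at G" "transpose G ** V = 0"
  shows "quot_metric (ortho_class G)
      (riem_hess quot quot_smooth quot_metric nabla (quot_objective C) (ortho_class G) (push G V)) (push G V) =
    2 * (V \<bullet> (C ** V) + stack (\<lambda>i. block V i ** (transpose (block G i) ** block V i)) \<bullet> (C ** G))"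
proof -
  let ?q = "ortho_class G" and ?f = "quot_objective C" and ?Z = "induced_field (grad_lift C)"
  have q: "?q \<in> quot" by (simp add: ortho_class_in_quot G)
  obtain B where B: "\<And>i. skew (B i)" "left_mult B G = V"
    "left_mult B V = stack (\<lambda>i. block V i ** (transpose (block G i) ** block V i))"
    using ex_left_mult_tangent[OF G V(1)] by blast
  have gr: "grad_lift C G \<in> tangent_at G"
    using equivariant_grad_lift[of C] G by (simp add: equivariant_field_def)
  \<comment> \<open>Only (nabla_Y Y)f = <grad f, nabla_Y Y> has to vanish.
    \<open>connection_left_mult_self\<close> tests against left multiplication fields, so the
    gradient vector at \<open>G\<close> is extended to one.\<close>
  obtain B' where B': "\<And>i. skew (B' i)" "left_mult B' G = grad_lift C G"
    using ex_left_mult_tangent[OF G gr] by blast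
  define Y where "Y = induced_field (left_mult B)"
  define X where "X = (SOME X. X \<in> vector_fields quot quot_smooth \<and> X ?q = push G V)"
  note e = equivariant_left_mult[of B, OF B(1)]
  have Y: "Y \<in> vector_fields quot quot_smooth" "Y ?q = push G V"
    unfolding Y_def using induced_field_vector_field[OF e] induced_field_class[OF e G] B(2) by auto
  \<comment> \<open>\<open>Y\<close> witnesses that the SOME in \<open>riem_hess\<close> really
    selects an extension of the tangent vector.\<close>
  then have "\<exists>X. X \<in> vector_fields quot quot_smooth \<and> X ?q = push G V" by blast
  then have X: "X \<in> vector_fields quot quot_smooth" "X ?q = push G V"
    unfolding X_def by (metis (mono_tags, lifting) someI_ex)+
  have "nabla Y Y \<in> vector_fields quot quot_smooth"
    using lc Y quot_objective_smooth unfolding levi_civita_def affine_connection_def by blast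
  then have "nabla Y Y ?q \<in> tangent_space quot quot_smooth ?q" using q by (simp add: vector_fields_def)
  then have "nabla Y Y ?q ?f = quot_metric ?q (?Z ?q) (nabla Y Y ?q)"
    using metric_grad_field[OF C q] by simp
  also have "?Z ?q = induced_field (left_mult B') ?q"
    by (simp add: induced_field_class equivariant_grad_lift equivariant_left_mult G B')
  also have "quot_metric ?q \<dots> (nabla Y Y ?q) = 0"
    unfolding quot_metric_commute[of _ "induced_field _ _"] Y_def
    by (rule connection_left_mult_self[of nabla G B B', OF lc G B(1) B'(1)])
       (simp_all add: B(2) B'(2) V grad_lift_horizontal G C)
  finally have 0: "nabla Y Y ?q ?f = 0" .
  have "quot_metric ?q (nabla X ?Z ?q) (Y ?q) = Y ?q (\<lambda>p. Y p ?f)"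
    using connection_grad_metric_extension[OF lc C X(1) Y(1) q] X Y 0 by simp
  also have "\<dots> = 2 * (left_mult B V \<bullet> (C ** G) + left_mult B G \<bullet> (C ** V))"
    unfolding Y(2) unfolding Y_def by (rule push_left_mult_quot_objective[of G _ C B, OF G V(1) C B(1)])
  finally show ?thesis
    unfolding riem_hess_def X_def[symmetric] riem_grad_quot_objective[OF C] Y(2) B(2,3) by (simp add: add.commute)
qed

section \<open>Alignment and the eigenvalue bound\<close>

lemma inner_mat_1_trace: "mat 1 \<bullet> (N::real^'d^'d) = trace N"
  using trace_transpose_mult[of "mat 1" N] by simp

lemma compact_orthogonal_matrices: "compact {Q::real^'d^'d. orthogonal_matrix Q}"
proof -
  have "closed {Q::real^'d^'d. transpose Q ** Q = mat 1}"
    by (intro closed_Collect_eq bounded_bilinear.continuous_on[OF bounded_bilinear_matrix_mult]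
        bounded_linear.continuous_on[OF bounded_linear_transpose] continuous_intros)
  moreover have "bounded {Q::real^'d^'d. orthogonal_matrix Q}"
    unfolding bounded_iff
    by (intro exI[of _ "norm (mat 1 :: real^'d^'d)"] ballI)
       (use norm_orthogonal_mult_left[of _ "mat 1 :: real^'d^'d"] in auto)
  ultimately show ?thesis by (simp add: compact_eq_bounded_closed orthogonal_matrix)
qed

definition reflection :: "real^'d \<Rightarrow> real^'d^'d" where
  "reflection u = mat 1 - (2 / (u \<bullet> u)) *\<^sub>R (\<chi> i j. u$i * u$j)"

lemma orthogonal_reflection: "u \<noteq> 0 \<Longrightarrow> orthogonal_matrix (reflection u)"
proof -
  assume u: "u \<noteq> 0"
  let ?W = "(\<chi> i j. u$i * u$j) :: real^'a^'a" and ?c = "2 / (u \<bullet> u)"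
  have W: "?W ** ?W = (u \<bullet> u) *\<^sub>R ?W"
    by (simp add: vec_eq_iff matrix_matrix_mult_def inner_vec_def sum_distrib_left sum_distrib_right mult_ac)
  have T: "transpose ?W = ?W" by (simp add: vec_eq_iff transpose_def mult.commute)
  have "transpose (reflection u) ** reflection u = mat 1 - (2 * ?c) *\<^sub>R ?W + (?c * ?c * (u \<bullet> u)) *\<^sub>R ?W"
    unfolding reflection_def transpose_linear_simps T transpose_mat matrix_mult_linear_simps W
    by (simp add: algebra_simps flip: scaleR_add_left)
  also have "?c * ?c * (u \<bullet> u) = 2 * ?c" using u by (simp add: field_simps)
  finally show ?thesis by (simp add: orthogonal_matrix)
qed

lemma inner_reflection: "reflection u \<bullet> N = trace N - (2 / (u \<bullet> u)) * (u \<bullet> (N *v u))"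
proof -
  have "(\<chi> i j. u$i * u$j) \<bullet> N = u \<bullet> (N *v u)"
    by (simp add: inner_matrix_eq inner_vec_def matrix_vector_mult_def sum_distrib_left mult_ac)
  then show ?thesis by (simp add: reflection_def inner_diff_left inner_mat_1_trace)
qed

text \<open>The orthogonal polar factor, obtained by maximizing a linear function over the orthogonal
  group: rotations give symmetry and reflections give positivity.\<close>

lemma polar_alignment:
  fixes P :: "real^'d^'d"
  shows "\<exists>Q. orthogonal_matrix Q \<and> transpose (transpose Q ** P) = transpose Q ** P \<and>
    (\<forall>u. 0 \<le> u \<bullet> ((transpose Q ** P) *v u))"
proof -
  have "\<exists>Q\<in>{Q::real^'d^'d. orthogonal_matrix Q}. \<forall>R\<in>{Q. orthogonal_matrix Q}. R \<bullet> P \<le> Q \<bullet> P"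
    using orthogonal_matrix_id
    by (intro continuous_attains_sup compact_orthogonal_matrices continuous_intros) auto
  then obtain Q :: "real^'d^'d" where Q: "orthogonal_matrix Q"
    and max: "\<And>R. orthogonal_matrix R \<Longrightarrow> R \<bullet> P \<le> Q \<bullet> P" by auto
  define N where "N = transpose Q ** P"
  have maxN: "R \<bullet> N \<le> trace N" if "orthogonal_matrix R" for R
  proof -
    have "R \<bullet> N = (Q ** R) \<bullet> P" by (simp add: N_def inner_matrix_mult_left)
    also have "\<dots> \<le> (Q ** mat 1) \<bullet> P" using max[OF orthogonal_matrix_mul[OF Q that]] by simp
    also have "\<dots> = mat 1 \<bullet> N" unfolding N_def by (rule inner_matrix_mult_left)
    finally show ?thesis by (simp add: inner_mat_1_trace)
  qed
  have orth: "A \<bullet> N = 0" if A: "skew A" for A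
  proof -
    have "((\<lambda>t. cayley A t \<bullet> N) has_vector_derivative A \<bullet> N) (at 0)"
      by (rule bounded_linear.has_vector_derivative[OF bounded_linear_inner_left has_vector_derivative_cayley[OF A]])
    then have "DERIV (\<lambda>t. cayley A t \<bullet> N) 0 :> A \<bullet> N"
      by (simp add: has_real_derivative_iff_has_vector_derivative)
    then show ?thesis
      by (rule DERIV_local_max[of _ _ _ 1])
         (auto simp: cayley_0[OF A] inner_mat_1_trace intro: maxN orthogonal_cayley[OF A])
  qed
  have "(N - transpose N) \<bullet> (N - transpose N) = 0"
  proof -
    have "(N - transpose N) \<bullet> transpose N = transpose (N - transpose N) \<bullet> N"
      by (subst inner_transpose[symmetric]) simp
    also have "\<dots> = - ((N - transpose N) \<bullet> N)" by (simp add: transpose_linear_simps inner_diff_left)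
    finally show ?thesis using orth[OF skew_diff_transpose] by (simp add: inner_diff_right)
  qed
  then have sym: "transpose N = N" by simp
  have pos: "0 \<le> u \<bullet> (N *v u)" for u
  proof (cases "u = 0")
    case False
    then have "(2 / (u \<bullet> u)) * (u \<bullet> (N *v u)) \<ge> 0"
      using maxN[OF orthogonal_reflection[OF False]] by (simp add: inner_reflection)
    moreover have "2 / (u \<bullet> u) > 0" using False by simp
    ultimately show ?thesis by (simp only: zero_le_mult_iff) linarith
  qed simp
  show ?thesis using Q sym pos unfolding N_def by blast
qed

lemma inner_psd_mult:
  fixes N :: "real^'d^'d"
  assumes "\<And>u. 0 \<le> u \<bullet> (N *v u)"
  shows "0 \<le> X \<bullet> (N ** (X::real^'p^'d))"
proof -
  have "X \<bullet> Y = (\<Sum>j\<in>UNIV. column j X \<bullet> column j Y)" for X Y :: "real^'p^'d"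
    by (simp add: inner_vec_def column_def) (rule sum.swap)
  moreover have "column j (N ** X) = N *v column j X" for j
    by (simp add: vec_eq_iff column_def matrix_matrix_mult_def matrix_vector_mult_def)
  ultimately show ?thesis by (simp add: sum_nonneg assms)
qed

text \<open>For eigenvalues in [0, n] this is lambda^2 <= n lambda. Diagonalisation is avoided by
  expanding 0 <= tr((n-N) N (n-N)) = n^2 tr N - 2n |N|^2 + tr N^3, where Cauchy-Schwarz and the
  bound on \<open>N ** N\<close> give tr N^3 <= n |N|^2.\<close>

lemma norm_square_le_trace:
  fixes N :: "real^'d^'d"
  assumes "transpose N = N" "\<And>u. 0 \<le> u \<bullet> (N *v u)" "0 < n" "norm (N ** N) \<le> n * norm N"
  shows "(norm N)\<^sup>2 \<le> n * trace N"
proof -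
  let ?X = "n *\<^sub>R mat 1 - N"
  have "0 \<le> ?X \<bullet> (N ** ?X)" by (rule inner_psd_mult[OF assms(2)])
  also have "?X \<bullet> (N ** ?X) = n * n * trace N - 2 * n * (N \<bullet> N) + N \<bullet> (N ** N)"
    using inner_symmetric_mult[OF assms(1), of "mat 1" N]
    by (simp add: matrix_mult_linear_simps inner_diff_left inner_diff_right inner_mat_1_trace algebra_simps)
  also have "N \<bullet> (N ** N) \<le> norm N * (n * norm N)"
    using norm_cauchy_schwarz[of N "N ** N"] assms(4) by (meson mult_left_mono norm_ge_zero order_trans)
  finally have "0 \<le> n * (n * trace N - (norm N)\<^sup>2)"
    by (simp add: power2_norm_eq_inner[symmetric] algebra_simps power2_eq_square)
  then show ?thesis using assms(3) by (simp add: zero_le_mult_iff)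
qed

lemma norm_ortho_prod_mult:
  fixes G :: "real^'d^('n::finite \<times> 'd::finite)"
  assumes "G \<in> ortho_prod"
  shows "norm (G ** X) = sqrt (real CARD('n)) * norm (X::real^'p^'d)"
proof -
  have "(G ** X) \<bullet> (G ** X) = real CARD('n) * (X \<bullet> X)"
    by (simp add: inner_matrix_mult_left matrix_mul_assoc ortho_prod_transpose_mult[OF assms] matrix_mult_linear_simps)
  then show ?thesis by (simp add: norm_eq_sqrt_inner real_sqrt_mult)
qed

lemma norm_ortho_prod:
  fixes G :: "real^'d^('n::finite \<times> 'd::finite)"
  assumes "G \<in> ortho_prod"
  shows "norm G = sqrt (real CARD('n)) * sqrt (real CARD('d))"
  using norm_ortho_prod_mult[OF assms, of "mat 1"] by (simp add: norm_eq_sqrt_inner inner_mat_1)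

lemma norm_transpose_ortho_prod_mult_le:
  fixes G :: "real^'d^('n::finite \<times> 'd::finite)" and Y :: "real^'p^('n \<times> 'd)"
  assumes "G \<in> ortho_prod"
  shows "norm (transpose G ** Y) \<le> sqrt (real CARD('n)) * norm Y"
proof -
  let ?Z = "transpose G ** Y"
  have "(norm ?Z)\<^sup>2 = (G ** ?Z) \<bullet> Y"
    by (simp add: power2_norm_eq_inner inner_matrix_mult_left)
  also have "\<dots> \<le> norm (G ** ?Z) * norm Y" by (rule norm_cauchy_schwarz)
  also have "\<dots> = (sqrt (real CARD('n)) * norm Y) * norm ?Z"
    by (simp add: norm_ortho_prod_mult[OF assms])
  finally show ?thesis
    by (cases "norm ?Z = 0") (simp_all add: power2_eq_square mult_le_cancel_right)
qed

lemma signal_noise_form: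
  fixes X Y :: "real^'k^'m" and Z :: "real^'p^'m" and \<Delta> :: "real^'m^'m"
  shows "X \<bullet> ((Z ** transpose Z + \<Delta>) ** Y) = (transpose Z ** X) \<bullet> (transpose Z ** Y) + X \<bullet> (\<Delta> ** Y)"
  by (simp add: matrix_mult_linear_simps inner_add_right inner_vertical[of X Z] flip: matrix_mul_assoc)

lemma abs_inner_op_norm_le:
  fixes X :: "real^'k^'m" and Y :: "real^'k^'p"
  shows "\<bar>X \<bullet> (\<Delta> ** Y)\<bar> \<le> op_norm \<Delta> * norm X * norm Y"
proof -
  have "\<bar>X \<bullet> (\<Delta> ** Y)\<bar> \<le> norm X * norm (\<Delta> ** Y)" by (rule Cauchy_Schwarz_ineq2)
  also have "\<dots> \<le> norm X * (op_norm \<Delta> * norm Y)" by (intro mult_left_mono op_norm_matrix_mult_le) auto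
  finally show ?thesis by (simp add: mult_ac)
qed

section \<open>Distance between a maximizer and the aligned ground truth\<close>

context
  fixes Z Ghat :: "real^'d^('n::finite \<times> 'd::finite)"
    and \<Delta> :: "real^('n \<times> 'd)^('n \<times> 'd)" and N :: "real^'d^'d" and n :: real
  assumes Z: "Z \<in> ortho_prod" and Ghat: "Ghat \<in> ortho_prod"
    and \<Delta>: "transpose \<Delta> = \<Delta>"
    and max: "\<And>G. G \<in> ortho_prod \<Longrightarrow>
      objective (Z ** transpose Z + \<Delta>) G \<le> objective (Z ** transpose Z + \<Delta>) Ghat"
    and N_def: "N = transpose Z ** Ghat" and n_def: "n = real CARD('n)"
    and N_sym: "transpose N = N" and N_psd: "\<And>u. 0 \<le> u \<bullet> (N *v u)"
begin

text \<open>Comparing with \<open>Z\<close>, the signal loses at least n (n d - tr N), where d =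
  CARD('d), because |N|^2 <= n tr N for semidefinite \<open>N\<close>; this equals n e^2 / 2 for the
  error e = |Ghat - Z|. The noise gains <Ghat - Z, \<Delta> (Ghat + Z)>, which is only linear in e,
  so one factor e cancels.\<close>

lemma alignment_error: "n * norm (Ghat - Z) \<le> 4 * op_norm \<Delta> * (sqrt n * sqrt (real CARD('d)))"
proof -
  let ?d = "real CARD('d)" and ?e = "norm (Ghat - Z)"
  have n: "n > 0" by (simp add: n_def)
  have nm: "norm Ghat = sqrt n * sqrt ?d" "norm Z = sqrt n * sqrt ?d"
    unfolding n_def by (intro norm_ortho_prod Z Ghat)+
  have ZZ: "transpose Z ** Z = n *\<^sub>R mat 1" unfolding n_def by (rule ortho_prod_transpose_mult[OF Z])
  have "norm (N ** N) \<le> n * norm N"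
  proof -
    have "norm (N ** N) \<le> sqrt n * norm (Ghat ** N)"
      unfolding N_def n_def matrix_mul_assoc[symmetric]
      by (rule norm_transpose_ortho_prod_mult_le[OF Z])
    also have "\<dots> = n * norm N" using n by (simp add: norm_ortho_prod_mult[OF Ghat] flip: n_def)
    finally show ?thesis .
  qed
  then have 1: "(norm N)\<^sup>2 \<le> n * trace N" by (rule norm_square_le_trace[OF N_sym N_psd n])
  have GZ: "Ghat \<bullet> Z = trace N"
    unfolding N_def trace_transpose_mult by (rule inner_commute)
  have 2: "?e\<^sup>2 = 2 * n * ?d - 2 * trace N"
  proof -
    have "Ghat \<bullet> Ghat = n * ?d" "Z \<bullet> Z = n * ?d"
      using nm n by (simp_all add: power_mult_distrib flip: power2_norm_eq_inner)
    then show ?thesis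
      by (simp add: power2_norm_eq_inner inner_diff_left inner_diff_right inner_commute[of Z Ghat] GZ)
  qed
  have "objective (Z ** transpose Z + \<Delta>) Z \<le> objective (Z ** transpose Z + \<Delta>) Ghat" by (rule max[OF Z])
  then have 3: "n * n * ?d + Z \<bullet> (\<Delta> ** Z) \<le> (norm N)\<^sup>2 + Ghat \<bullet> (\<Delta> ** Ghat)"
    unfolding objective_eq signal_noise_form ZZ
    by (simp add: inner_mat_1 power2_norm_eq_inner flip: N_def)
  have "Ghat \<bullet> (\<Delta> ** Ghat) - Z \<bullet> (\<Delta> ** Z) = (Ghat - Z) \<bullet> (\<Delta> ** (Ghat + Z))"
    using inner_symmetric_mult[OF \<Delta>, of Z Ghat] inner_commute[of "\<Delta> ** Z" Ghat]
    by (simp add: matrix_mult_linear_simps inner_diff_left inner_add_right)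
  also have "\<dots> \<le> op_norm \<Delta> * ?e * norm (Ghat + Z)" using abs_inner_op_norm_le abs_le_D1 by blast
  also have "\<dots> \<le> op_norm \<Delta> * ?e * (2 * (sqrt n * sqrt ?d))"
    using norm_triangle_ineq[of Ghat Z] nm by (intro mult_left_mono mult_nonneg_nonneg op_norm_nonneg) auto
  finally have "n * n * ?d - n * trace N \<le> op_norm \<Delta> * ?e * (2 * (sqrt n * sqrt ?d))"
    using 1 3 by linarith
  then have "2 * (n * n * ?d - n * trace N) \<le> 2 * (op_norm \<Delta> * ?e * (2 * (sqrt n * sqrt ?d)))"
    by (rule mult_left_mono) simp
  also have "2 * (n * n * ?d - n * trace N) = n * ?e\<^sup>2" by (simp add: 2 algebra_simps)
  finally have 4: "(n * ?e) * ?e \<le> (4 * op_norm \<Delta> * (sqrt n * sqrt ?d)) * ?e"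
    by (simp add: power2_eq_square mult_ac)
  show ?thesis
  proof (cases "?e = 0")
    case True
    then show ?thesis using n by (simp add: op_norm_nonneg del: norm_eq_zero)
  next
    case False
    then show ?thesis
      using 4 by (simp only: mult_le_cancel_right) (use norm_ge_zero[of "Ghat - Z"] in linarith)
  qed
qed

text \<open>Symmetry of \<open>N\<close> turns the Gram matrix of \<open>Ghat - Z\<close> into
  exactly 2 (n 1 - N), so this error is quadratic in the distance.\<close>

lemma alignment_gram_error: "norm (n *\<^sub>R mat 1 - N) \<le> (norm (Ghat - Z))\<^sup>2 / 2"
proof -
  have "transpose (Ghat - Z) ** (Ghat - Z) = n *\<^sub>R mat 1 - transpose N - N + n *\<^sub>R mat 1"
    using ortho_prod_transpose_mult[OF Z] ortho_prod_transpose_mult[OF Ghat]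
    by (simp add: transpose_linear_simps matrix_mult_linear_simps N_def n_def matrix_transpose_mul)
  moreover have "a - b - b + a = 2 *\<^sub>R (a - b)" for a b :: "real^'d^'d"
    by (simp add: vec_eq_iff)
  ultimately have "2 *\<^sub>R (n *\<^sub>R mat 1 - N) = transpose (Ghat - Z) ** (Ghat - Z)"
    by (simp only: N_sym)
  then have "2 * norm (n *\<^sub>R mat 1 - N) = norm (transpose (Ghat - Z) ** (Ghat - Z))"
    by (metis norm_scaleR abs_numeral)
  also have "\<dots> \<le> (norm (Ghat - Z))\<^sup>2"
    using norm_matrix_mult_le[of "transpose (Ghat - Z)" "Ghat - Z"] by (simp add: norm_transpose power2_eq_square)
  finally show ?thesis by simp
qed

text \<open>Replacing a single block of the maximizer by the corresponding block of \<open>Z\<close> does not increase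
  the objective.\<close>

lemma alignment_block_error:
  assumes "norm (n *\<^sub>R mat 1 - N) \<le> n / 50" "norm (block (\<Delta> ** Ghat) i) \<le> 6 * n / 100"
    and "op_norm \<Delta> \<le> n / 20"
  shows "norm (block (Z - Ghat) i) \<le> 17 / 100"
proof -
  define D where "D = block Z i - block Ghat i"
  define W where "W = (stack (\<lambda>j. if j = i then D else 0) :: real^'d^('n \<times> 'd))"
  let ?C = "Z ** transpose Z + \<Delta>" and ?x = "norm D"
  have n: "n > 0" by (simp add: n_def)
  have WX: "W \<bullet> X = D \<bullet> block X i" for X :: "real^'d^('n \<times> 'd)"
    by (simp add: inner_block W_def if_distrib[of "\<lambda>A. A \<bullet> _"] cong: if_cong)
  have nW: "norm W = ?x" by (simp add: norm_eq_sqrt_inner WX) (simp add: W_def)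
  have C: "transpose ?C = ?C" by (simp add: transpose_linear_simps matrix_transpose_mul \<Delta>)
  have "Ghat + W \<in> ortho_prod"
    using Z Ghat by (auto simp: ortho_prod_def W_def D_def)
  then have "objective ?C (Ghat + W) \<le> objective ?C Ghat" by (rule max)
  then have 1: "2 * (W \<bullet> (?C ** Ghat)) + W \<bullet> (?C ** W) \<le> 0"
    using inner_symmetric_mult[OF C, of Ghat W] inner_commute[of "?C ** Ghat" W]
    by (simp add: objective_eq bounded_bilinear.add_right[OF bounded_bilinear_matrix_mult]
        inner_add_left inner_add_right)
  have "W \<bullet> (\<Delta> ** W) \<ge> - (op_norm \<Delta> * ?x * ?x)"
    using abs_inner_op_norm_le[of W \<Delta> W] by (simp add: nW)
  moreover have "op_norm \<Delta> * ?x * ?x \<le> n / 20 * ?x * ?x"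
    using assms(3) by (intro mult_right_mono) auto
  \<comment> \<open>The signal part of the quadratic term is a squared norm and is dropped.\<close>
  ultimately have 2: "W \<bullet> (?C ** W) \<ge> - (n / 20 * ?x * ?x)"
    using inner_ge_zero[of "transpose Z ** W"] unfolding signal_noise_form by linarith
  have "W \<bullet> (?C ** Ghat) = D \<bullet> (block Z i ** N) + D \<bullet> block (\<Delta> ** Ghat) i"
    unfolding WX by (simp add: matrix_mult_linear_simps inner_add_right N_def flip: matrix_mul_assoc)
  also have "D \<bullet> (block Z i ** N) = n * (D \<bullet> block Z i) - D \<bullet> (block Z i ** (n *\<^sub>R mat 1 - N))"
    by (simp add: matrix_mult_linear_simps inner_diff_right)
  also have "D \<bullet> block Z i = ?x * ?x / 2"
  proof -
    have "block Z i \<bullet> block Z i = real CARD('d)" "block Ghat i \<bullet> block Ghat i = real CARD('d)"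
      using norm_orthogonal_matrix_square ortho_prodD Z Ghat by (metis power2_norm_eq_inner)+
    moreover have "?x * ?x = D \<bullet> D" by (metis power2_eq_square power2_norm_eq_inner)
    ultimately show ?thesis
      by (simp add: D_def inner_diff_left inner_diff_right inner_commute[of "block Ghat i" "block Z i"])
  qed
  finally have 3: "W \<bullet> (?C ** Ghat) = n * (?x * ?x / 2) - D \<bullet> (block Z i ** (n *\<^sub>R mat 1 - N))
      + D \<bullet> block (\<Delta> ** Ghat) i" .
  have "D \<bullet> (block Z i ** (n *\<^sub>R mat 1 - N)) \<le> ?x * norm (n *\<^sub>R mat 1 - N)"
    using norm_cauchy_schwarz[of D "block Z i ** (n *\<^sub>R mat 1 - N)"]
    by (simp add: norm_orthogonal_mult_left ortho_prodD[OF Z])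
  also have "\<dots> \<le> ?x * (n / 50)" by (intro mult_left_mono assms) auto
  finally have 4: "D \<bullet> (block Z i ** (n *\<^sub>R mat 1 - N)) \<le> ?x * (n / 50)" .
  have "\<bar>D \<bullet> block (\<Delta> ** Ghat) i\<bar> \<le> ?x * norm (block (\<Delta> ** Ghat) i)" by (rule Cauchy_Schwarz_ineq2)
  also have "\<dots> \<le> ?x * (6 * n / 100)" by (intro mult_left_mono assms) auto
  finally have 5: "D \<bullet> block (\<Delta> ** Ghat) i \<ge> - (?x * (6 * n / 100))" by linarith
  have "2 * s - 2 * u - 2 * w - t \<le> 0" if "2 * a + b \<le> 0" "- t \<le> b" "a = s - p + c" "p \<le> u" "- w \<le> c"
    for a b c p s t u w :: real using that by linarith
  from this[OF 1 2 3 4 5]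
  have "2 * (n * (?x * ?x / 2)) - 2 * (?x * (n / 50)) - 2 * (?x * (6 * n / 100)) - n / 20 * ?x * ?x \<le> 0" .
  \<comment> \<open>Multiplied by 100: 95 comes from 1 - 1/20 and 16 from 2 (1/50 + 6/100). Hence
    \<open>?x\<close> is at most 16/95, which is below 0.17.\<close>
  then have "(n * ?x) * (95 * ?x - 16) \<le> 0" by (simp add: algebra_simps)
  then have "?x \<le> 17 / 100"
  proof (rule contrapos_pp)
    assume "\<not> ?x \<le> 17 / 100"
    then have "0 < ?x" "0 < 95 * ?x - 16" by linarith+
    then have "0 < n * ?x" "0 < 95 * ?x - 16" using n by (simp_all only: mult_pos_pos)
    then show "\<not> (n * ?x) * (95 * ?x - 16) \<le> 0" by (simp only: not_le mult_pos_pos)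
  qed
  then show ?thesis by (simp add: D_def)
qed

end

section \<open>Negativity of the Hessian form near the aligned ground truth\<close>

lemma inner_skew_square:
  fixes A K L :: "real^'d^'d"
  assumes "orthogonal_matrix K" "orthogonal_matrix L" "skew A"
  shows "(K ** A ** A) \<bullet> L \<le> (norm A)\<^sup>2 * ((norm (L - K))\<^sup>2 / 2 - 1)"
proof -
  \<comment> \<open>\<open>K ** A\<close> and \<open>L ** A\<close> both have norm |A|, and by
    skewness the wanted pairing is -<KA, LA>, which equals |(L - K)A|^2 / 2 - |A|^2.\<close>
  have "(norm ((L - K) ** A))\<^sup>2 \<le> (norm (L - K) * norm A)\<^sup>2"
    by (intro power_mono norm_matrix_mult_le) auto
  moreover have "(norm ((L - K) ** A))\<^sup>2 = (norm (L ** A))\<^sup>2 + (norm (K ** A))\<^sup>2 - 2 * ((K ** A) \<bullet> (L ** A))"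
    by (simp add: matrix_mult_linear_simps power2_norm_eq_inner inner_diff_left inner_diff_right
        inner_commute[of "L ** A" "K ** A"])
  moreover have "(K ** A) \<bullet> (L ** A) = - ((K ** A ** A) \<bullet> L)"
    using inner_matrix_mult_right[of "K ** A" A L] skewD[OF assms(3)]
    by (simp add: matrix_mult_linear_simps)
  ultimately show ?thesis
    by (simp add: norm_orthogonal_mult_left assms power_mult_distrib algebra_simps)
qed

text \<open>In units of n <V,V>: the signal part of the first term is at most (3/10)^2, its noise
  part at most 1/20, and the curvature term at most -0.6 block by block. The claimed -1/10 becomes
  -1/5 through the factor 2 of the Hessian formula.\<close>

lemma hessian_form_bound:
  fixes G Ghat Z V :: "real^'d^('n::finite \<times> 'd::finite)"
    and \<Delta> :: "real^('n \<times> 'd)^('n \<times> 'd)"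
  defines "n \<equiv> real CARD('n)"
  assumes G: "G \<in> ortho_prod" and Z: "Z \<in> ortho_prod"
    and V: "V \<in> tangent_at G" "transpose G ** V = 0"
    and gram: "norm (n *\<^sub>R mat 1 - transpose Z ** G) \<le> 12 * n / 100"
    and op: "op_norm \<Delta> \<le> n / 20" and noise: "\<And>i. norm (block (\<Delta> ** G) i) \<le> 16 * n / 100"
    and dist: "norm (G - Z) \<le> 3 / 10 * sqrt n" and blocks: "\<And>i. norm (block (Z - G) i) \<le> 42 / 100"
  shows "V \<bullet> ((Z ** transpose Z + \<Delta>) ** V) +
      stack (\<lambda>i. block V i ** (transpose (block G i) ** block V i)) \<bullet> ((Z ** transpose Z + \<Delta>) ** G)
    \<le> - (n / 10) * (V \<bullet> V)"
proof -
  define A where "A i = transpose (block G i) ** block V i" for i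
  let ?C = "Z ** transpose Z + \<Delta>" and ?F = "n *\<^sub>R mat 1 - transpose Z ** G"
  have n: "n > 0" by (simp add: n_def)
  have A: "skew (A i)" for i unfolding A_def by (rule tangent_atD[OF V(1)])
  have VA: "block V i = block G i ** A i" for i unfolding A_def by (rule block_tangent[OF G])
  have nA: "norm (block V i) = norm (A i)" for i
    by (simp add: VA norm_orthogonal_mult_left ortho_prodD[OF G])
  have "transpose Z ** V = transpose (Z - G) ** V"
    by (simp add: transpose_linear_simps matrix_mult_linear_simps V(2))
  then have "norm (transpose Z ** V) \<le> norm (G - Z) * norm V"
    using norm_matrix_mult_le[of "transpose (Z - G)" V] by (simp add: norm_transpose norm_minus_commute)
  also have "\<dots> \<le> 3 / 10 * sqrt n * norm V" by (intro mult_right_mono dist) auto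
  finally have "(norm (transpose Z ** V))\<^sup>2 \<le> (3 / 10 * sqrt n * norm V)\<^sup>2"
    by (intro power_mono) auto
  also have "\<dots> = 9 / 100 * n * (V \<bullet> V)"
    by (simp only: power_mult_distrib power2_norm_eq_inner real_sqrt_pow2[OF less_imp_le[OF n]])
       (simp add: power2_eq_square)
  finally have 1: "(transpose Z ** V) \<bullet> (transpose Z ** V) \<le> 9 / 100 * n * (V \<bullet> V)"
    by (simp add: power2_norm_eq_inner)
  have "V \<bullet> (\<Delta> ** V) \<le> op_norm \<Delta> * norm V * norm V"
    using abs_inner_op_norm_le abs_le_D1 by blast
  also have "\<dots> \<le> n / 20 * norm V * norm V" by (intro mult_right_mono op) auto
  finally have 2: "V \<bullet> (\<Delta> ** V) \<le> n / 20 * (V \<bullet> V)"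
    by (simp add: power2_norm_eq_inner[symmetric] power2_eq_square)
  have 3: "(block V i ** A i) \<bullet> block (?C ** G) i \<le> - (6 / 10 * n) * (block V i \<bullet> block V i)" for i
  proof -
    let ?a = "norm (A i)" and ?W = "block V i ** A i"
    have W: "norm ?W \<le> ?a\<^sup>2"
      using norm_matrix_mult_le[of "block V i" "A i"] by (simp add: nA power2_eq_square)
    have "?W \<bullet> block Z i \<le> ?a\<^sup>2 * ((norm (block Z i - block G i))\<^sup>2 / 2 - 1)"
      unfolding VA by (rule inner_skew_square[OF ortho_prodD[OF G] ortho_prodD[OF Z] A])
    also have "\<dots> \<le> ?a\<^sup>2 * ((42 / 100)\<^sup>2 / 2 - 1)"
      using blocks[of i] by (intro mult_left_mono diff_right_mono divide_right_mono power_mono) auto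
    finally have "n * (?W \<bullet> block Z i) \<le> n * (?a\<^sup>2 * ((42 / 100)\<^sup>2 / 2 - 1))"
      using n by (intro mult_left_mono) auto
    moreover have "\<bar>?W \<bullet> (block Z i ** ?F)\<bar> \<le> ?a\<^sup>2 * (12 * n / 100)"
      using Cauchy_Schwarz_ineq2[of ?W "block Z i ** ?F"] mult_mono[OF W gram] n
      by (simp add: norm_orthogonal_mult_left ortho_prodD[OF Z])
    moreover have "\<bar>?W \<bullet> block (\<Delta> ** G) i\<bar> \<le> ?a\<^sup>2 * (16 * n / 100)"
      using Cauchy_Schwarz_ineq2[of ?W "block (\<Delta> ** G) i"] mult_mono[OF W noise[of i]] n by simp
    moreover have "?W \<bullet> block (?C ** G) i =
        n * (?W \<bullet> block Z i) - ?W \<bullet> (block Z i ** ?F) + ?W \<bullet> block (\<Delta> ** G) i"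
      by (simp add: matrix_mult_linear_simps inner_add_right inner_diff_right flip: matrix_mul_assoc)
    ultimately have "?W \<bullet> block (?C ** G) i \<le> n * (?a\<^sup>2 * ((42 / 100)\<^sup>2 / 2 - 1)) +
        ?a\<^sup>2 * (12 * n / 100) + ?a\<^sup>2 * (16 * n / 100)"
      by linarith
    \<comment> \<open>0.6318 = 1 - 0.42^2/2 - 0.12 - 0.16: what remains of the signal after the
      block error, the Gram error and the noise.\<close>
    also have "\<dots> = - (6318 / 10000) * (n * ?a\<^sup>2)" by (simp add: power2_eq_square algebra_simps)
    also have "\<dots> \<le> - (6 / 10 * n) * ?a\<^sup>2" using n by simp
    also have "?a\<^sup>2 = block V i \<bullet> block V i" by (metis nA power2_norm_eq_inner)
    finally show ?thesis .
  qed
  have "stack (\<lambda>i. block V i ** A i) \<bullet> (?C ** G) = (\<Sum>i\<in>UNIV. (block V i ** A i) \<bullet> block (?C ** G) i)"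
    by (simp add: inner_block)
  also have "\<dots> \<le> (\<Sum>i\<in>UNIV. - (6 / 10 * n) * (block V i \<bullet> block V i))" by (intro sum_mono 3)
  also have "\<dots> = - (6 / 10 * n) * (V \<bullet> V)" unfolding inner_block[of V] by (rule sum_distrib_left[symmetric])
  finally have "stack (\<lambda>i. block V i ** A i) \<bullet> (?C ** G) \<le> - (6 / 10 * n) * (V \<bullet> V)" .
  moreover have "0 \<le> n * (V \<bullet> V)" using n by simp
  ultimately show ?thesis
    using 1 2 unfolding signal_noise_form[of V] A_def[symmetric] by (simp add: algebra_simps)
qed

section \<open>From the hypotheses to the numerical bounds\<close>

lemma norm_block_le_block_norm_inf: "norm (block X i) \<le> block_norm_inf X"
  unfolding block_norm_inf_def by (rule Max_ge) auto

theorem theorem5p1: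
  fixes Gstar Ghat G :: "real^'d^('n::finite \<times> 'd::finite)"
    and \<Delta> C :: "real^('n \<times> 'd)^('n \<times> 'd)"
    and Qhat :: "real^'d^'d"
    and nabla :: "(real^'d^('n \<times> 'd)) set connection"
  assumes "Gstar \<in> ortho_prod"
    and "transpose \<Delta> = \<Delta>"
    and "C = Gstar ** transpose Gstar + \<Delta>"
    and "Ghat \<in> ortho_prod"
    and "\<forall>G'\<in>ortho_prod. objective C G' \<le> objective C Ghat"
    and "op_norm \<Delta> \<le> real CARD('n) powr (3/4) / (20 * real CARD('d) powr (1/2))"
    and "block_norm_inf (\<Delta> ** Gstar) \<le> real CARD('n) / 20"
    and "levi_civita quot quot_smooth quot_metric nabla"
    and "G \<in> ortho_prod"
    and "orthogonal_matrix Qhat"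
    and "dist_F G Ghat = norm (G ** Qhat - Ghat)"
    and "dist_F G Ghat \<le> rho_F \<Delta>"
    and "block_norm_inf (G ** Qhat - Ghat) \<le> rho_inf"
  shows "\<forall>H \<in> tangent_space quot quot_smooth (ortho_class G) - {zero_tvec}.
    - quot_metric (ortho_class G)
        (riem_hess quot quot_smooth quot_metric nabla (quot_objective C) (ortho_class G) H) H
      \<ge> real CARD('n) / 5 * quot_metric (ortho_class G) H H \<and>
    real CARD('n) / 5 * quot_metric (ortho_class G) H H > 0"
proof -
  \<comment> \<open>With r = n^(1/4) all fractional powers of n become integer powers of r, ordered
    by r >= 1.\<close>
  define n d r where "n = real CARD('n)" and "d = real CARD('d)" and "r = n powr (1/4)"
  have d: "1 \<le> sqrt d" and r: "1 \<le> r" by (auto simp: d_def r_def n_def ge_one_powr_ge_zero)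
  have n_r: "n = r ^ 4" and sqrt_n: "sqrt n = r\<^sup>2" and n_34: "n powr (3/4) = r ^ 3"
    by (simp_all add: r_def n_def powr_powr powr_half_sqrt flip: powr_numeral)
  have n: "n > 0" by (simp add: n_def)
  have r2: "r \<le> r\<^sup>2" "r\<^sup>2 \<le> n" "r ^ 3 \<le> n"
    unfolding n_r using r power_increasing[of 1 2 r] by (auto intro!: power_increasing)
  let ?\<delta> = "op_norm \<Delta>"
  have \<delta>0: "0 \<le> ?\<delta>" by (rule op_norm_nonneg)
  have \<delta>d: "?\<delta> * sqrt d \<le> r ^ 3 / 20"
    using assms(6) d by (simp add: powr_half_sqrt field_simps n_34 flip: n_def d_def)
  have "?\<delta> * 1 \<le> ?\<delta> * sqrt d" using d \<delta>0 by (rule mult_left_mono)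
  then have \<delta>: "?\<delta> \<le> r ^ 3 / 20" using \<delta>d by simp
  have \<delta>n: "?\<delta> \<le> n / 20" using \<delta> r2(3) by simp

  \<comment> \<open>The rotation is moved from \<open>G\<close> to the maximizer: the objective is
    unchanged, and the two distance hypotheses become bounds on \<open>G - Gh\<close>.\<close>
  define Gh where "Gh = Ghat ** transpose Qhat"
  have Qt: "orthogonal_matrix (transpose Qhat)" using assms(10) by simp
  have Gh: "Gh \<in> ortho_prod" unfolding Gh_def by (rule ortho_prod_mult[OF assms(4) Qt])
  have GGh: "(G - Gh) ** Qhat = G ** Qhat - Ghat"
    by (simp add: Gh_def matrix_mult_linear_simps orthogonal_matrix_mult_transpose assms(10))
  let ?e = "norm (G - Gh)"
  have "?e = norm (G ** Qhat - Ghat)"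
    unfolding GGh[symmetric] by (rule norm_orthogonal_mult_right[OF assms(10), symmetric])
  then have e: "?e \<le> rho_F \<Delta>" using assms(11,12) by simp
  have eb: "norm (block (G - Gh) i) \<le> 1 / 4" for i
    using norm_block_le_block_norm_inf[of "G ** Qhat - Ghat" i] assms(13)
    unfolding GGh[symmetric] by (simp add: norm_orthogonal_mult_right assms(10) rho_inf_def)
  have e1: "?e \<le> r\<^sup>2 / 10"
    using e by (auto simp: rho_F_def sqrt_n split: if_splits simp flip: n_def)
  \<comment> \<open>The second entry of the minimum in \<open>rho_F\<close> serves this bound:
    passing from the maximizer to \<open>G\<close> changes each block of the noise term by at most
    n/10. The case of zero norm covers the infinite reading of the quotient.\<close>
  have e2: "?\<delta> * ?e \<le> n / 10"
  proof (cases "?\<delta> = 0")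
    case False
    then have "\<Delta> \<noteq> 0" by (auto simp: op_norm_def onorm_zero)
    then have "?e \<le> n / ?\<delta> / 10" using e by (auto simp: rho_F_def simp flip: n_def)
    then show ?thesis using False \<delta>0 by (simp add: field_simps)
  qed (use n in simp)

  \<comment> \<open>Rotating \<open>Gstar\<close> leaves Gstar Gstar^T, hence \<open>C\<close>,
    unchanged, so the ground truth may be replaced by the representative whose Gram matrix with
    \<open>Gh\<close> is symmetric and positive semidefinite.\<close>
  obtain Q where Q: "orthogonal_matrix Q"
    "transpose (transpose Q ** (transpose Gstar ** Gh)) = transpose Q ** (transpose Gstar ** Gh)"
    "\<And>u. 0 \<le> u \<bullet> ((transpose Q ** (transpose Gstar ** Gh)) *v u)"
    using polar_alignment[of "transpose Gstar ** Gh"] by blast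
  define Z where "Z = Gstar ** Q"
  define N where "N = transpose Z ** Gh"
  have Z: "Z \<in> ortho_prod" unfolding Z_def by (rule ortho_prod_mult[OF assms(1) Q(1)])
  have N: "N = transpose Q ** (transpose Gstar ** Gh)"
    by (simp add: N_def Z_def matrix_transpose_mul matrix_mul_assoc)
  have C: "C = Z ** transpose Z + \<Delta>"
    by (simp add: assms(3) Z_def matrix_transpose_mul matrix_mul_assoc orthogonal_matrix_mult_transpose Q(1))
  have "objective C Gh = objective C Ghat"
    by (simp add: Gh_def objective_eq matrix_mul_assoc inner_orthogonal_mult_right assms(10))
  then have max: "objective (Z ** transpose Z + \<Delta>) G' \<le> objective (Z ** transpose Z + \<Delta>) Gh"
    if "G' \<in> ortho_prod" for G'
    using assms(5) that unfolding C by simp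
  note align = Z Gh assms(2) max N_def n_def Q(2,3)[folded N]
  let ?\<epsilon> = "norm (Gh - Z)"
  have "n * ?\<epsilon> \<le> 4 * ?\<delta> * (sqrt n * sqrt d)"
    unfolding d_def by (rule alignment_error[OF align])
  also have "\<dots> = 4 * r\<^sup>2 * (?\<delta> * sqrt d)" by (simp add: sqrt_n)
  also have "\<dots> \<le> 4 * r\<^sup>2 * (r ^ 3 / 20)" by (intro mult_left_mono \<delta>d) auto
  also have "\<dots> = n * (r / 5)" by (simp add: n_r power2_eq_square power3_eq_cube power4_eq_xxxx)
  finally have \<epsilon>: "?\<epsilon> \<le> r / 5" using n by simp
  have "norm (n *\<^sub>R mat 1 - N) \<le> ?\<epsilon>\<^sup>2 / 2" by (rule alignment_gram_error[OF align])
  also have "\<dots> \<le> (r / 5)\<^sup>2 / 2" using \<epsilon> by (intro divide_right_mono power_mono) auto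
  also have "\<dots> \<le> n / 50" using r2 by (simp add: power_divide)
  finally have gram: "norm (n *\<^sub>R mat 1 - N) \<le> n / 50" .
  have Zn: "norm (block (\<Delta> ** Z) i) \<le> n / 20" for i
    using norm_block_le_block_norm_inf[of "\<Delta> ** Gstar" i] assms(7)
    by (simp add: Z_def matrix_mul_assoc norm_orthogonal_mult_right Q(1) n_def)
  have blk: "norm (block (\<Delta> ** (X + Y)) i) \<le> norm (block (\<Delta> ** X) i) + ?\<delta> * norm Y"
    for X Y :: "real^'d^('n \<times> 'd)" and i
    using norm_triangle_ineq[of "block (\<Delta> ** X) i" "block (\<Delta> ** Y) i"]
      norm_block_le[of "\<Delta> ** Y" i] op_norm_matrix_mult_le[of \<Delta> Y]
    by (simp add: matrix_mult_linear_simps)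
  \<comment> \<open>A crude operator norm bound on \<Delta> (Gh - Z) suffices blockwise: r^3/20
    times r/5 is n/100. Only \<Delta> Z needs the separate blockwise hypothesis on the
    noise.\<close>
  have "?\<delta> * ?\<epsilon> \<le> r ^ 3 / 20 * (r / 5)" using \<delta> \<epsilon> r by (intro mult_mono) auto
  also have "\<dots> = n / 100" by (simp add: n_r power3_eq_cube power4_eq_xxxx)
  finally have "?\<delta> * ?\<epsilon> \<le> n / 100" .
  then have Ghn: "norm (block (\<Delta> ** Gh) i) \<le> 6 * n / 100" for i
    using blk[of Z "Gh - Z" i] Zn[of i] by simp
  \<comment> \<open>0.16 = 0.05 + 0.01 + 0.1: the steps from \<open>Z\<close> to \<open>Gh\<close>
    and from \<open>Gh\<close> to \<open>G\<close> are added to the blockwise hypothesis.\<close>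
  have Gn: "norm (block (\<Delta> ** G) i) \<le> 16 * n / 100" for i
    using blk[of Gh "G - Gh" i] Ghn[of i] e2 by simp
  have Zb: "norm (block (Z - Gh) i) \<le> 17 / 100" for i
    by (rule alignment_block_error[OF align gram Ghn \<delta>n])
  \<comment> \<open>0.42 is 0.17 for the maximizer plus the radius 1/4 of the neighbourhood.\<close>
  have blocks: "norm (block (Z - G) i) \<le> 42 / 100" for i
  proof -
    have "norm (block (Z - G) i) \<le> norm (block (Z - Gh) i) + norm (block (G - Gh) i)"
      using norm_triangle_ineq4[of "block (Z - Gh) i" "block (G - Gh) i"] by simp
    then show ?thesis using Zb[of i] eb[of i] by linarith
  qed
  \<comment> \<open>3/10 = 1/10 + 1/5; the alignment error r/5 is absorbed into r^2/5 = sqrt n /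
    5.\<close>
  have dist: "norm (G - Z) \<le> 3 / 10 * sqrt n"
    using norm_triangle_ineq[of "G - Gh" "Gh - Z"] e1 \<epsilon> r2(1) by (simp add: sqrt_n)
  have "norm (transpose Z ** (G - Gh)) \<le> sqrt n * ?e"
    unfolding n_def by (rule norm_transpose_ortho_prod_mult_le[OF Z])
  also have "\<dots> \<le> r\<^sup>2 * (r\<^sup>2 / 10)" unfolding sqrt_n by (intro mult_left_mono e1) simp
  also have "\<dots> = n / 10" by (simp add: n_r power2_eq_square power4_eq_xxxx)
  finally have "norm (n *\<^sub>R mat 1 - transpose Z ** G) \<le> 12 * n / 100"
    using norm_triangle_ineq4[of "n *\<^sub>R mat 1 - N" "transpose Z ** (G - Gh)"] gram
    by (simp add: N_def matrix_mult_linear_simps)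
  note bound = hessian_form_bound[OF assms(9) Z _ _ this[unfolded n_def] \<delta>n[unfolded n_def] Gn[unfolded n_def]
      dist[unfolded n_def] blocks, folded C n_def]

  have sym: "transpose C = C" by (simp add: C transpose_linear_simps matrix_transpose_mul assms(2))
  show ?thesis
  proof
    fix H assume H: "H \<in> tangent_space quot quot_smooth (ortho_class G) - {zero_tvec}"
    then obtain V0 where V0: "V0 \<in> tangent_at G" "H = push G V0"
      using tangent_space_quot[OF assms(9)] by blast
    \<comment> \<open>The horizontal part pushes to the same \<open>H\<close>, and the Hessian
      formula and the bound both require a horizontal vector.\<close>
    define V where "V = hor G V0"
    have V: "V \<in> tangent_at G" "transpose G ** V = 0" "H = push G V"
      using V0 assms(9) by (simp_all add: V_def hor_tangent_at transpose_mult_hor push_hor)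
    have "V \<noteq> 0"
      using H V(3) push_vertical[OF assms(9) skew_simps(1)] by (auto simp: matrix_mult_linear_simps)
    then have "0 < V \<bullet> V" by simp
    moreover have "quot_metric (ortho_class G) H H = V \<bullet> V"
      unfolding V(3) by (simp add: quot_metric_push[OF assms(9) V(1) V(1)] hor_horizontal[OF V(2)])
    moreover have "- quot_metric (ortho_class G)
        (riem_hess quot quot_smooth quot_metric nabla (quot_objective C) (ortho_class G) H) H \<ge> n / 5 * (V \<bullet> V)"
      unfolding V(3) riem_hess_quot_objective[OF assms(8) sym assms(9) V(1,2)]
      using bound[OF V(1,2)] by simp
    ultimately show "- quot_metric (ortho_class G)
        (riem_hess quot quot_smooth quot_metric nabla (quot_objective C) (ortho_class G) H) H
      \<ge> real CARD('n) / 5 * quot_metric (ortho_class G) H H \<and>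
      real CARD('n) / 5 * quot_metric (ortho_class G) H H > 0"
      using n by (simp add: n_def)
  qed
qed

end
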